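(* Let $p\in(1,\infty)$, $l\in(0,p)$, $n\in[1,\infty)$ (a real number), $R\in(0,\infty]$, $\theta\in(0,1]$. Let $\phi:\mathbb{R}\to\mathbb{R}$ be a continuous odd function with $\tau\phi(\tau)>0$ for almost every $\tau$. Let $a\in W^{1,1}_{loc}([0,R))$ with $a>0$ a.e. on $(0,R)$. Let $h=h(\tau,\lambda_0,\lambda_1):(0,R)\times\mathbb{R}^2\to\mathbb{R}$ be a Carathéodory function and let $q:(0,R)\to[0,\infty)$ be in $L^1_{loc}([0,R))$. Let $u\in W^{1,1}_{loc}((0,R))$ be such that $\Phi_p(u')\in W^{1,1}_{loc}([0,R))$ (in particular $u,u'\in C([0,R))$) and $u(0)=0$. Suppose that one of the following two cases holds, and define $v$ accordingly: ($\mathcal{ND}$) $v:=\delta_a$, and $u$ satisfies for a.e. $\tau\in(0,R)$ $$a(\tau)(\Phi_p(u'(\tau)))'+(n-1)\frac{a(\tau)}{\tau}\Phi_p(u'(\tau))-h(\tau,u(\tau),u'(\tau))+\phi(u(\tau))=0;$$ ($\mathcal{D}$) $v:=d_a$, and $u$ satisfies for a.e. $\tau\in(0,R)$ $$(a(\tau)\Phi_p(u'(\tau)))'+(n-1)\frac{a(\tau)}{\tau}\Phi_p(u'(\tau))-h(\tau,u(\tau),u'(\tau))+\phi(u(\tau))=0.$$ Assume, for this $v$, that $v>0$ a.e. on $(0,R)$, that $v\in L^1_{loc}([0,R))$ and $v^{-1/(p-1)}\in L^1_{loc}([0,R))$, that for a.e. $\tau\in(0,R)$ and all $\lambda_0,\lambda_1\in\mathbb{R}$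 $$h(\tau,\lambda_0,\lambda_1)\lambda_1\le\theta q(\tau)|\lambda_0|^l|\lambda_1|^{p-l}+(1-\theta)v(\tau)|\lambda_1|^p,$$ and that $K(0,r,q,v)<\infty$ for every $0<r<R$. Put $K:=K(0,R,q,v)$. Then: i) If $K\le1$ and $\Phi(\tau):=\int_0^\tau\phi(s)\,ds$, then $$\sup_{r\in(0,R)}|u(r)|\le\Phi^{-1}\left(\left(1-\frac1p\right)a(0)|u'(0)|^p\right).$$ ii) If $a(0)=0$ or $u'(0)=0$, then the only possible solution is $u\equiv0$. In that situation, if moreover $h(\cdot,0,0)$ is not a.e. equal to $0$ on $(0,R)$, then there are no such solutions.
   Context: $\Phi_p(\lambda)=|\lambda|^{p-2}\lambda$ for $\lambda\ne0$ and $\Phi_p(0)=0$. $L^1_{loc}([0,R)):=\bigcap_{0<r<R}L^1((0,r))$ and $W^{1,1}_{loc}([0,R)):=\bigcap_{0<r<R}W^{1,1}((0,r))$; functions in the latter space are identified with their continuous representatives on $[0,R)$. $W^{1,1}_{loc}((0,R))$ is the usual local Sobolev space on the open interval. If $R=\infty$, $(0,R)$ denotes $(0,\infty)$. A Carathéodory function $h(\tau,\lambda_0,\lambda_1)$ is measurable in $\tau$ and continuous in $(\lambda_0,\lambda_1)$. For a.e. $\tau\in(0,R)$: $\delta_a(\tau):=(n-1)\frac{a(\tau)}{\tau}-\left(1-\frac1p\right)a'(\tau)$ and $d_a(\tau):=(n-1)\frac{a(\tau)}{\tau}+\frac1p a'(\tau)$. For $0\le s<r\le R$, measurable $q\ge0$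 and $v>0$ a.e., $$K(s,r,q,v):=\left(\frac{p-l}{p}\right)^{\frac{p-l}{p}}\left[\int_s^r q(t)^{\frac pl}v(t)^{-\frac{p-l}{l}}\left(\int_s^t v(\sigma)^{-\frac1{p-1}}d\sigma\right)^{p-1}dt\right]^{\frac lp}.$$ $\Phi^{-1}$ denotes the inverse of the strictly increasing function $\Phi$ restricted to $[0,\infty)$, with the convention that $\Phi^{-1}$ equals $+\infty$ at arguments $\geq \sup_{[0,\infty)}\Phi$. *)

theory Defs
  imports "HOL-Analysis.Analysis"
begin

(* For R :: ereal with 0 < R, the open interval (0,R) is rendered as einterval 0 R,
   which covers R = \<infinity>; the half-open interval [0,R) is the following. *)

definition half_open :: "ereal \<Rightarrow> real set" where
  "half_open R = {t. 0 \<le> t \<and> ereal t < R}"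

subsection \<open>Function spaces\<close>

definition test_fun :: "real set \<Rightarrow> (real \<Rightarrow> real) \<Rightarrow> bool" where
  "test_fun I \<psi> \<longleftrightarrow>
     (\<forall>k. ((deriv ^^ k) \<psi>) differentiable_on UNIV) \<and>
     (\<exists>C. compact C \<and> C \<subseteq> I \<and> (\<forall>x. x \<notin> C \<longrightarrow> \<psi> x = 0))"

definition locally_L1 :: "real set \<Rightarrow> (real \<Rightarrow> real) \<Rightarrow> bool" where
  "locally_L1 I f \<longleftrightarrow> (\<forall>C. compact C \<and> C \<subseteq> I \<longrightarrow> f absolutely_integrable_on C)"

(* For open I: f belongs to the local Sobolev space of exponents (1,1) on I, and g is
   (a version of) its weak derivative. *)
definition weak_deriv_on :: "real set \<Rightarrow> (real \<Rightarrow> real) \<Rightarrow> (real \<Rightarrow> real) \<Rightarrow> bool" where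
  "weak_deriv_on I f g \<longleftrightarrow>
     locally_L1 I f \<and> locally_L1 I g \<and>
     (\<forall>\<psi>. test_fun I \<psi> \<longrightarrow>
        (LINT x:I|lebesgue. f x * deriv \<psi> x) = - (LINT x:I|lebesgue. g x * \<psi> x))"

definition sobolev_W11 :: "real set \<Rightarrow> (real \<Rightarrow> real) \<Rightarrow> bool" where
  "sobolev_W11 I f \<longleftrightarrow>
     f absolutely_integrable_on I \<and>
     (\<exists>g. g absolutely_integrable_on I \<and> weak_deriv_on I f g)"

definition L1_loc_half_open :: "ereal \<Rightarrow> (real \<Rightarrow> real) \<Rightarrow> bool" where
  "L1_loc_half_open R f \<longleftrightarrow>
     (\<forall>r. 0 < r \<and> ereal r < R \<longrightarrow> f absolutely_integrable_on {0<..<r})"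

(* Elements are represented by their continuous representative on [0,R), so that point
   values, in particular the value at 0, are meaningful. *)
definition W11_loc_half_open :: "ereal \<Rightarrow> (real \<Rightarrow> real) \<Rightarrow> bool" where
  "W11_loc_half_open R f \<longleftrightarrow>
     continuous_on (half_open R) f \<and>
     (\<forall>r. 0 < r \<and> ereal r < R \<longrightarrow> sobolev_W11 {0<..<r} f)"

definition caratheodory :: "ereal \<Rightarrow> (real \<Rightarrow> real \<Rightarrow> real \<Rightarrow> real) \<Rightarrow> bool" where
  "caratheodory R h \<longleftrightarrow>
     (\<forall>x y. (\<lambda>\<tau>. h \<tau> x y) \<in> borel_measurable (lebesgue_on (einterval 0 R))) \<and>
     (\<forall>\<tau>\<in>einterval 0 R. continuous_on UNIV (\<lambda>(x, y). h \<tau> x y))"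

subsection \<open>Coefficients and the constant K\<close>

definition Phi_p :: "real \<Rightarrow> real \<Rightarrow> real" where
  "Phi_p p x = (if x = 0 then 0 else \<bar>x\<bar> powr (p - 2) * x)"

(* In both coefficients a' is a version of the weak derivative of a. *)
definition delta_coeff ::
  "real \<Rightarrow> real \<Rightarrow> (real \<Rightarrow> real) \<Rightarrow> (real \<Rightarrow> real) \<Rightarrow> real \<Rightarrow> real" where
  "delta_coeff p n a a' \<tau> = (n - 1) * a \<tau> / \<tau> - (1 - 1 / p) * a' \<tau>"

definition d_coeff ::
  "real \<Rightarrow> real \<Rightarrow> (real \<Rightarrow> real) \<Rightarrow> (real \<Rightarrow> real) \<Rightarrow> real \<Rightarrow> real" where
  "d_coeff p n a a' \<tau> = (n - 1) * a \<tau> / \<tau> + 1 / p * a' \<tau>"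

(* Power with a positive real exponent on [0,\<infinity>]. *)
definition ennpowr :: "ennreal \<Rightarrow> real \<Rightarrow> ennreal" where
  "ennpowr x c = (if x = \<infinity> then \<infinity> else ennreal (enn2real x powr c))"

definition K_const ::
  "real \<Rightarrow> real \<Rightarrow> ereal \<Rightarrow> ereal \<Rightarrow> (real \<Rightarrow> real) \<Rightarrow> (real \<Rightarrow> real) \<Rightarrow> ennreal" where
  "K_const p l s r q v =
     ennreal (((p - l) / p) powr ((p - l) / p)) *
     ennpowr
       (\<integral>\<^sup>+t\<in>einterval s r.
          (ennreal (q t powr (p / l) * v t powr (- ((p - l) / l))) *
           ennpowr (\<integral>\<^sup>+\<sigma>\<in>einterval s (ereal t). ennreal (v \<sigma> powr (- 1 / (p - 1))) \<partial>lebesgue) (p - 1))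
        \<partial>lebesgue)
       (l / p)"

definition primitive :: "(real \<Rightarrow> real) \<Rightarrow> real \<Rightarrow> real" where
  "primitive \<phi> \<tau> = (LBINT s=0..ereal \<tau>. \<phi> s)"

(* Inverse of a function F on [0,\<infinity>), extended by \<infinity> at and above its supremum. *)
definition ext_inverse :: "(real \<Rightarrow> real) \<Rightarrow> real \<Rightarrow> ereal" where
  "ext_inverse F y =
     (if ereal y \<ge> (SUP x\<in>{0..}. ereal (F x)) then \<infinity> else ereal (inv_into {0..} F y))"

subsection \<open>Solutions\<close>

(* u' is the weak derivative of u on (0,R), in the version for which Phi_p p o u' is
   continuous up to 0; this fixes the value u' 0. *)
definition admissible ::
  "real \<Rightarrow> ereal \<Rightarrow> (real \<Rightarrow> real) \<Rightarrow> (real \<Rightarrow> real) \<Rightarrow> bool" where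
  "admissible p R u u' \<longleftrightarrow>
     weak_deriv_on (einterval 0 R) u u' \<and>
     continuous_on (half_open R) u \<and>
     W11_loc_half_open R (\<lambda>\<tau>. Phi_p p (u' \<tau>)) \<and>
     u 0 = 0"

definition ND_solution ::
  "real \<Rightarrow> real \<Rightarrow> ereal \<Rightarrow> (real \<Rightarrow> real) \<Rightarrow> (real \<Rightarrow> real) \<Rightarrow> (real \<Rightarrow> real \<Rightarrow> real \<Rightarrow> real) \<Rightarrow>
   (real \<Rightarrow> real) \<Rightarrow> (real \<Rightarrow> real) \<Rightarrow> bool" where
  "ND_solution p n R \<phi> a h u u' \<longleftrightarrow>
     admissible p R u u' \<and>
     (\<exists>w. weak_deriv_on (einterval 0 R) (\<lambda>\<tau>. Phi_p p (u' \<tau>)) w \<and>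
       (AE \<tau>\<in>einterval 0 R in lebesgue.
          a \<tau> * w \<tau> + (n - 1) * a \<tau> / \<tau> * Phi_p p (u' \<tau>)
            - h \<tau> (u \<tau>) (u' \<tau>) + \<phi> (u \<tau>) = 0))"

definition D_solution ::
  "real \<Rightarrow> real \<Rightarrow> ereal \<Rightarrow> (real \<Rightarrow> real) \<Rightarrow> (real \<Rightarrow> real) \<Rightarrow> (real \<Rightarrow> real \<Rightarrow> real \<Rightarrow> real) \<Rightarrow>
   (real \<Rightarrow> real) \<Rightarrow> (real \<Rightarrow> real) \<Rightarrow> bool" where
  "D_solution p n R \<phi> a h u u' \<longleftrightarrow>
     admissible p R u u' \<and>
     (\<exists>w. weak_deriv_on (einterval 0 R) (\<lambda>\<tau>. a \<tau> * Phi_p p (u' \<tau>)) w \<and>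
       (AE \<tau>\<in>einterval 0 R in lebesgue.
          w \<tau> + (n - 1) * a \<tau> / \<tau> * Phi_p p (u' \<tau>)
            - h \<tau> (u \<tau>) (u' \<tau>) + \<phi> (u \<tau>) = 0))"

end

theory Submission
  imports Defs
begin

text \<open>
The proof is an energy argument. Along a solution the energy
  \<open>E = (1 - 1/p) * a * \<bar>u'\<bar> powr p + primitive \<phi> u\<close> is absolutely continuous. Multiplying either form of
  the equation by \<open>u'\<close> gives \<open>E' = h * u' - v * \<bar>u'\<bar> powr p\<close> almost everywhere: \<open>v\<close> is precisely the
  coefficient that collects the friction term and the part of \<open>a'\<close> which differentiation of \<open>E\<close>
  leaves over. The two forms of the equation differ only in that part, so after this point they
  are treated together (\<open>energy_solution\<close>). The growth condition on \<open>h\<close> then yields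
  \<open>E(r) - E(0) \<le> \<theta> * (\<integral> q * \<bar>u\<bar> powr l * \<bar>u'\<bar> powr (p - l) - \<integral> v * \<bar>u'\<bar> powr p)\<close>, with integrals over
  \<open>{0..r}\<close>.

  The constant \<open>K\<close> is what a weighted inequality of Opial type needs to bound the first integral
  by \<open>K\<close> times the second (\<open>Opial_inequality\<close>). If \<open>K \<le> 1\<close>, the energy never exceeds its initial
  value. As \<open>a \<ge> 0\<close>, this bounds \<open>primitive \<phi> \<bar>u\<bar>\<close>, and the primitive is strictly increasing on the
  half-line, which gives the a priori bound.

  If \<open>a 0 = 0\<close> or \<open>u' 0 = 0\<close>, the initial energy vanishes, and \<open>E(r) \<le> 0\<close> forces \<open>u r = 0\<close>. Here \<open>K\<close>
  may exceed 1, so one proceeds in small steps: if \<open>u\<close> vanishes on \<open>{0..s}\<close>, Opial's inequality on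
  \<open>{0..r}\<close> holds with the integral defining \<open>K\<close> taken over \<open>{s..r}\<close> only, and this is small when \<open>r\<close>
  is close to \<open>s\<close>. A compactness argument (\<open>zero_solution\<close>) propagates \<open>u = 0\<close> to the whole
  interval. Inserting \<open>u = 0\<close> in the equation leaves \<open>h \<tau> 0 0 = 0\<close> almost everywhere.

  The solutions are given by weak derivatives, tested against smooth functions of compact support.
  Testing with a smooth approximation of the indicator function of an interval shows that a continuous
  function with weak derivative \<open>g\<close> has the increments of an indefinite integral of \<open>g\<close>
  (\<open>weak_deriv_on_increment\<close>). This is turned into a small calculus of absolutely continuous functions
  with chain rule, product rule and uniqueness of the derivative almost everywhere (\<open>abs_cont_deriv\<close>).
\<close>

section \<open>Smooth functions and a smooth step\<close>

definition smooth :: "(real \<Rightarrow> real) \<Rightarrow> bool" where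
  "smooth f \<longleftrightarrow> (\<forall>k. (deriv ^^ k) f differentiable_on UNIV)"

text \<open>
  A class of functions each of which has a derivative in the same class consists of smooth
  functions. All closure properties of smoothness below are instances.
\<close>

lemma smooth_coinduct:
  assumes "P f"
    and step: "\<And>g. P g \<Longrightarrow> \<exists>g'. P g' \<and> (\<forall>x. (g has_real_derivative g' x) (at x))"
  shows "smooth f"
proof -
  have "P ((deriv ^^ k) f)" for k
  proof (induction k)
    case (Suc k)
    then obtain g' where g': "P g'" "\<And>x. ((deriv ^^ k) f has_real_derivative g' x) (at x)"
      using step by blast
    then have "deriv ((deriv ^^ k) f) = g'"
      by (intro ext DERIV_imp_deriv)
    with g' show ?case by simp
  qed (use assms in simp)
  then show ?thesis
    unfolding smooth_def differentiable_on_def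
    by (metis step differentiableI real_differentiable_def differentiable_at_withinI)
qed

lemma smooth_has_deriv:
  assumes "smooth f"
  shows "(f has_real_derivative deriv f x) (at x)" "smooth (deriv f)"
proof -
  have "f differentiable (at x)"
    using assms[unfolded smooth_def, rule_format, of 0]
    by (simp add: differentiable_on_def)
  then show "(f has_real_derivative deriv f x) (at x)"
    by (metis DERIV_imp_deriv real_differentiable_def)
  show "smooth (deriv f)"
    unfolding smooth_def
  proof
    fix k
    show "(deriv ^^ k) (deriv f) differentiable_on UNIV"
      using assms[unfolded smooth_def, rule_format, of "Suc k"]
      by (simp add: funpow_swap1)
  qed
qed

lemma smooth_affine:
  assumes "smooth f"
  shows "smooth (\<lambda>x. A * f (\<alpha> * x + \<beta>))"
proof (rule smooth_coinduct[where P = "\<lambda>g. \<exists>A f. smooth f \<and> g = (\<lambda>x. A * f (\<alpha> * x + \<beta>))"])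
  fix g assume "\<exists>A f. smooth f \<and> g = (\<lambda>x. A * f (\<alpha> * x + \<beta>))"
  then obtain A f where f: "smooth f" and g: "g = (\<lambda>x. A * f (\<alpha> * x + \<beta>))" by blast
  have "(g has_real_derivative (A * \<alpha>) * deriv f (\<alpha> * x + \<beta>)) (at x)" for x
    unfolding g
    by (rule derivative_eq_intros DERIV_chain2[OF smooth_has_deriv(1)[OF f]] | simp)+
  with smooth_has_deriv(2)[OF f]
  show "\<exists>g'. (\<exists>A f. smooth f \<and> g' = (\<lambda>x. A * f (\<alpha> * x + \<beta>))) \<and>
      (\<forall>x. (g has_real_derivative g' x) (at x))" by blast
qed (use assms in blast)

lemma smooth_diff:
  assumes "smooth f" "smooth g"
  shows "smooth (\<lambda>x. f x - g x)"
proof (rule smooth_coinduct[where P = "\<lambda>h. \<exists>f g. smooth f \<and> smooth g \<and> h = (\<lambda>x. f x - g x)"])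
  fix h assume "\<exists>f g. smooth f \<and> smooth g \<and> h = (\<lambda>x. f x - g x)"
  then obtain f g where fg: "smooth f" "smooth g" and h: "h = (\<lambda>x. f x - g x)" by blast
  have "(h has_real_derivative deriv f x - deriv g x) (at x)" for x
    unfolding h by (intro derivative_intros smooth_has_deriv fg)
  with smooth_has_deriv(2)[OF fg(1)] smooth_has_deriv(2)[OF fg(2)]
  show "\<exists>h'. (\<exists>f g. smooth f \<and> smooth g \<and> h' = (\<lambda>x. f x - g x)) \<and>
      (\<forall>x. (h has_real_derivative h' x) (at x))" by blast
qed (use assms in blast)

text \<open>
  The smallest class containing all products of smooth functions that is stable under Leibniz' rule.
\<close>

inductive sum_of_smooth_products :: "(real \<Rightarrow> real) \<Rightarrow> bool" where
  prod: "smooth f \<Longrightarrow> smooth g \<Longrightarrow> sum_of_smooth_products (\<lambda>x. f x * g x)"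
| sum: "sum_of_smooth_products f \<Longrightarrow> sum_of_smooth_products g \<Longrightarrow>
    sum_of_smooth_products (\<lambda>x. f x + g x)"

lemma smooth_mult:
  assumes "smooth f" "smooth g"
  shows "smooth (\<lambda>x. f x * g x)"
proof (rule smooth_coinduct[where P = sum_of_smooth_products])
  fix h assume "sum_of_smooth_products h"
  then show "\<exists>h'. sum_of_smooth_products h' \<and> (\<forall>x. (h has_real_derivative h' x) (at x))"
  proof induction
    case (prod f g)
    have "((\<lambda>x. f x * g x) has_real_derivative deriv f x * g x + f x * deriv g x) (at x)" for x
      by (rule derivative_eq_intros smooth_has_deriv prod refl)+ simp
    moreover have "sum_of_smooth_products (\<lambda>x. deriv f x * g x + f x * deriv g x)"
      by (intro sum_of_smooth_products.intros prod smooth_has_deriv(2))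
    ultimately show ?case by blast
  next
    case (sum f g)
    then obtain f' g' where *: "sum_of_smooth_products f'" "sum_of_smooth_products g'"
      "\<And>x. (f has_real_derivative f' x) (at x)" "\<And>x. (g has_real_derivative g' x) (at x)"
      by blast
    have "((\<lambda>x. f x + g x) has_real_derivative f' x + g' x) (at x)" for x
      by (intro derivative_intros *)
    with sum_of_smooth_products.sum[OF *(1,2)] show ?case by blast
  qed
qed (use assms in \<open>blast intro: sum_of_smooth_products.prod\<close>)

text \<open>
  The functions \<open>P(1/x) * exp (-1/x)\<close>, extended by zero, form a class closed under differentiation
  that contains \<open>exp (-1/x)\<close>, the standard smooth function that is flat at the origin.
\<close>

definition flat :: "real poly \<Rightarrow> real \<Rightarrow> real" where
  "flat P x = (if x \<le> 0 then 0 else poly P (1 / x) * exp (- (1 / x)))"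

lemma poly_mult_exp_tendsto_0: "((\<lambda>y::real. poly P y * exp (- y)) \<longlongrightarrow> 0) at_top"
proof -
  have "((\<lambda>y::real. \<Sum>i\<le>degree P. coeff P i * (y ^ i / exp y)) \<longlongrightarrow> (\<Sum>i\<le>degree P. coeff P i * 0)) at_top"
    by (intro tendsto_intros tendsto_power_div_exp_0)
  then show ?thesis
    by (simp add: poly_altdef sum_distrib_right exp_minus divide_inverse mult.assoc)
qed

lemma flat_has_deriv:
  "(flat P has_real_derivative flat (monom 1 2 * (P - pderiv P)) x) (at x)"
proof (cases x "0::real" rule: linorder_cases)
  case less
  have "((\<lambda>_. 0) has_real_derivative 0) (at x)" by simp
  then have "(flat P has_real_derivative 0) (at x)"
    by (rule DERIV_cong_ev[THEN iffD1, rotated 3])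
       (use less in \<open>auto simp: flat_def intro!: eventually_mono[OF order_tendstoD(2)[OF tendsto_ident_at less]] eventually_nhds_in_open[of "{..<0}" x, THEN eventually_mono]\<close>)
  then show ?thesis using less by (simp add: flat_def)
next
  case equal
  have "((\<lambda>h. poly (pCons 0 P) (1/h) * exp (- (1/h))) \<longlongrightarrow> 0) (at_right 0)"
    using filterlim_compose[OF poly_mult_exp_tendsto_0 filterlim_inverse_at_top_right, of "pCons 0 P"]
    by (simp only: inverse_eq_divide)
  then have R: "((\<lambda>h. flat P h / h) \<longlongrightarrow> 0) (at_right 0)"
    by (rule Lim_transform_eventually)
       (auto simp: flat_def eventually_at_right_less eventually_at_filter)
  have L: "((\<lambda>h. flat P h / h) \<longlongrightarrow> 0) (at_left 0)"
    by (rule Lim_transform_eventually[OF tendsto_const])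
       (auto simp: flat_def eventually_at_filter)
  have "((\<lambda>h. flat P h / h) \<longlongrightarrow> 0) (at 0)"
    using L R by (simp add: filterlim_split_at)
  then show ?thesis using equal
    by (simp add: DERIV_def flat_def)
next
  case greater
  have "((\<lambda>x. poly P (1 / x) * exp (- (1 / x))) has_real_derivative
      (poly (pderiv P) (1/x) * (- 1 / x^2) * exp (- (1 / x)) + poly P (1/x) * (exp (- (1/x)) * (1/x^2)))) (at x)"
    using greater
    by (auto intro!: derivative_eq_intros DERIV_chain2[OF poly_DERIV] simp: power2_eq_square)
  moreover have "eventually (\<lambda>y. poly P (1 / y) * exp (- (1 / y)) = flat P y) (nhds x)"
    using eventually_nhds_in_open[of "{0<..}" x] greater
    by (auto simp: flat_def elim: eventually_mono)
  ultimately have "(flat P has_real_derivative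
      (poly (pderiv P) (1/x) * (- 1 / x^2) * exp (- (1 / x)) + poly P (1/x) * (exp (- (1/x)) * (1/x^2)))) (at x)"
    by (subst (asm) DERIV_cong_ev[OF refl _ refl])
  then show ?thesis using greater
    by (simp add: flat_def poly_monom field_simps)
qed

lemma smooth_rescale_has_deriv:
  assumes "smooth S"
  shows "((\<lambda>x. S (n * (x - c))) has_real_derivative n * deriv S (n * (x - c))) (at x)"
proof -
  have "((\<lambda>x. n * (x - c)) has_real_derivative n) (at x)"
    by (auto intro!: derivative_eq_intros)
  from DERIV_chain2[OF smooth_has_deriv(1)[OF assms] this] show ?thesis
    by (simp add: mult.commute)
qed

lemma smooth_flat: "smooth (flat P)"
proof (rule smooth_coinduct[where P = "\<lambda>g. \<exists>P. g = flat P"])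
  fix g assume "\<exists>P. g = flat P"
  then obtain P where "g = flat P" by blast
  then show "\<exists>g'. (\<exists>P. g' = flat P) \<and> (\<forall>x. (g has_real_derivative g' x) (at x))"
    using flat_has_deriv[of P] by blast
qed blast

lemma smooth_imp_continuous: "smooth f \<Longrightarrow> continuous_on A f"
  by (meson smooth_has_deriv(1) DERIV_isCont continuous_at_imp_continuous_on)

text \<open>
  The step is a normalised antiderivative of the bump function \<open>flat 1 x * flat 1 (1 - x)\<close>, which is
  positive exactly on the open unit interval.
\<close>

lemma smooth_step_exists:
  obtains S where "smooth S" "\<And>x. x \<le> 0 \<Longrightarrow> S x = 0" "\<And>x. 1 \<le> x \<Longrightarrow> S x = 1"
    "\<And>x. 0 \<le> deriv S x" "\<And>x. x \<le> 0 \<or> 1 \<le> x \<Longrightarrow> deriv S x = 0"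
proof -
  define B where "B x = flat 1 x * flat 1 (1 - x)" for x
  have smB: "smooth B"
    unfolding B_def using smooth_mult[OF smooth_flat smooth_affine[OF smooth_flat, of 1 _ "-1" 1]]
    by simp
  have B_pos: "B x > 0" if "0 < x" "x < 1" for x
    using that by (simp add: B_def flat_def)
  have B_zero: "B x = 0" if "x \<le> 0 \<or> 1 \<le> x" for x
    using that by (auto simp: B_def flat_def)
  have B_nonneg: "B x \<ge> 0" for x
    by (simp add: B_def flat_def)
  have "\<exists>F. \<forall>x. - \<infinity> < ereal x \<longrightarrow> ereal x < \<infinity> \<longrightarrow> (F has_vector_derivative B x) (at x)"
    by (rule einterval_antiderivative)
       (auto intro: DERIV_isCont smooth_has_deriv(1)[OF smB])
  then obtain F where F: "\<And>x. (F has_real_derivative B x) (at x)"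
    by (auto simp: has_real_derivative_iff_has_vector_derivative)
  have incr: "F 0 < F 1"
    by (rule DERIV_pos_imp_increasing_open)
       (use F B_pos in \<open>auto intro!: continuous_at_imp_continuous_on DERIV_isCont[OF F]\<close>)
  have F0: "F x = F 0" if "x \<le> 0" for x
  proof (cases "x < 0")
    case True
    show ?thesis
      by (rule DERIV_isconst_end[symmetric, OF True])
        (use F B_zero in \<open>auto intro!: continuous_at_imp_continuous_on DERIV_isCont[OF F], metis less_eq_real_def\<close>)
  qed (use that in auto)
  have F1: "F x = F 1" if "1 \<le> x" for x
  proof (cases "1 < x")
    case True
    show ?thesis
      by (rule DERIV_isconst_end[OF True])
        (use F B_zero in \<open>auto intro!: continuous_at_imp_continuous_on DERIV_isCont[OF F], metis less_eq_real_def\<close>)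
  qed (use that in auto)
  define S where "S x = (F x - F 0) / (F 1 - F 0)" for x
  have dS: "(S has_real_derivative (1 / (F 1 - F 0)) * B x) (at x)" for x
    unfolding S_def using incr by (auto intro!: derivative_eq_intros F)
  have dS': "deriv S x = (1 / (F 1 - F 0)) * B x" for x
    using dS by (rule DERIV_imp_deriv)
  have smd: "smooth (\<lambda>x. (1 / (F 1 - F 0)) * B x)"
    using smooth_affine[OF smB, of "1 / (F 1 - F 0)" 1 0] by simp
  have "smooth S"
  proof (rule smooth_coinduct[where P = "\<lambda>g. smooth g \<or> g = S"])
    fix g assume "smooth g \<or> g = S"
    then show "\<exists>g'. (smooth g' \<or> g' = S) \<and> (\<forall>x. (g has_real_derivative g' x) (at x))"
    proof
      assume "smooth g"
      with smooth_has_deriv[of g] show ?thesis by blast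
    next
      assume "g = S"
      with dS smd show ?thesis by blast
    qed
  qed simp
  moreover have "deriv S x \<ge> 0" for x
    using incr B_nonneg by (simp add: dS')
  moreover have "deriv S x = 0" if "x \<le> 0 \<or> 1 \<le> x" for x
    using B_zero[OF that] by (simp add: dS')
  moreover have "S x = 0" if "x \<le> 0" for x
    unfolding S_def F0[OF that] by simp
  moreover have "S x = 1" if "1 \<le> x" for x
    unfolding S_def F1[OF that] using incr by simp
  ultimately show ?thesis
    by (intro that[of S])
qed

section \<open>Absolutely continuous functions\<close>

text \<open>
  Absolute continuity on \<open>{a..b}\<close> in the form in which it is used: \<open>f\<close> is an indefinite integral of
  \<open>g\<close>, so that \<open>g\<close> is the derivative of \<open>f\<close> almost everywhere.
\<close>

definition abs_cont_deriv :: "real \<Rightarrow> real \<Rightarrow> (real \<Rightarrow> real) \<Rightarrow> (real \<Rightarrow> real) \<Rightarrow> bool" where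
  "abs_cont_deriv a b f g \<longleftrightarrow> g absolutely_integrable_on {a..b} \<and>
     (\<forall>x y. a \<le> x \<longrightarrow> x \<le> y \<longrightarrow> y \<le> b \<longrightarrow> f y - f x = integral {x..y} g)"

lemma abs_cont_derivD:
  assumes "abs_cont_deriv a b f g"
  shows "g absolutely_integrable_on {a..b}"
    and "\<And>x y. a \<le> x \<Longrightarrow> x \<le> y \<Longrightarrow> y \<le> b \<Longrightarrow> f y - f x = integral {x..y} g"
    and "\<And>x y. a \<le> x \<Longrightarrow> y \<le> b \<Longrightarrow> g absolutely_integrable_on {x..y}"
    and "\<And>x y. a \<le> x \<Longrightarrow> y \<le> b \<Longrightarrow> g integrable_on {x..y}"
    and "\<And>x y. a \<le> x \<Longrightarrow> y \<le> b \<Longrightarrow> (\<lambda>t. \<bar>g t\<bar>) integrable_on {x..y}"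
proof -
  show "g absolutely_integrable_on {a..b}"
    and "\<And>x y. a \<le> x \<Longrightarrow> x \<le> y \<Longrightarrow> y \<le> b \<Longrightarrow> f y - f x = integral {x..y} g"
    using assms by (auto simp: abs_cont_deriv_def)
  show *: "g absolutely_integrable_on {x..y}" if "a \<le> x" "y \<le> b" for x y
    using assms that by (auto simp: abs_cont_deriv_def intro: absolutely_integrable_on_subinterval)
  show "g integrable_on {x..y}" "(\<lambda>t. \<bar>g t\<bar>) integrable_on {x..y}" if "a \<le> x" "y \<le> b" for x y
    using *[OF that] by (auto simp: absolutely_integrable_on_def)
qed

lemma abs_cont_deriv_subinterval:
  assumes "abs_cont_deriv a b f g" "a \<le> c" "d \<le> b"
  shows "abs_cont_deriv c d f g"
  using assms abs_cont_derivD(3)[OF assms] by (auto simp: abs_cont_deriv_def)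

lemma abs_cont_deriv_continuous:
  assumes "abs_cont_deriv a b f g"
  shows "continuous_on {a..b} f"
proof (cases "a \<le> b")
  case True
  have "continuous_on {a..b} (\<lambda>x. f a + integral {a..x} g)"
    by (intro continuous_intros indefinite_integral_continuous_1 abs_cont_derivD[OF assms] order_refl)
  then show ?thesis
    by (rule continuous_on_eq) (use abs_cont_derivD(2)[OF assms, of a] in force)
qed auto

lemma abs_cont_deriv_lincomb:
  assumes f: "abs_cont_deriv a b f f'" and g: "abs_cont_deriv a b g g'"
  shows "abs_cont_deriv a b (\<lambda>x. A * f x + B * g x) (\<lambda>x. A * f' x + B * g' x)"
  unfolding abs_cont_deriv_def
proof (intro conjI allI impI)
  show "(\<lambda>x. A * f' x + B * g' x) absolutely_integrable_on {a..b}"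
    using abs_cont_derivD(1)[OF f] abs_cont_derivD(1)[OF g]
    by (intro set_integral_add set_integrable_mult_right)
  fix x y assume xy: "a \<le> x" "x \<le> y" "y \<le> b"
  have "integral {x..y} (\<lambda>x. A * f' x + B * g' x) = A * integral {x..y} f' + B * integral {x..y} g'"
    using abs_cont_derivD(4)[OF f xy(1,3)] abs_cont_derivD(4)[OF g xy(1,3)]
    by (subst integral_add) (auto intro: integrable_on_mult_right)
  also have "\<dots> = A * (f y - f x) + B * (g y - g x)"
    using abs_cont_derivD(2)[OF f xy] abs_cont_derivD(2)[OF g xy] by simp
  finally show "A * f y + B * g y - (A * f x + B * g x) = integral {x..y} (\<lambda>x. A * f' x + B * g' x)"
    by (simp add: algebra_simps)
qed

lemma absolutely_integrable_mult_continuous: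
  fixes f g :: "real \<Rightarrow> real"
  assumes "continuous_on {a..b} f" "g absolutely_integrable_on {a..b}"
  shows "(\<lambda>x. f x * g x) absolutely_integrable_on {a..b}"
  by (rule absolutely_integrable_bounded_measurable_product_real)
     (use assms in \<open>auto intro: continuous_imp_measurable_on_sets_lebesgue
        compact_imp_bounded compact_continuous_image\<close>)

text \<open>
  Let \<open>D c d\<close> be the error of the claimed formula on \<open>{c..d}\<close>; it is additive in the interval. Near any
  point \<open>z\<close> both \<open>G (f d) - G (f c)\<close> and the integral are close to \<open>G' (f z) * (f d - f c)\<close>, up to a small
  multiple of the integral of \<open>\<bar>g\<bar>\<close>. By bisection such a local bound holds on the whole interval, and
  the multiple is arbitrary.
\<close>

lemma abs_cont_deriv_compose:
  assumes f: "abs_cont_deriv a b f g"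
    and G: "\<And>x. (G has_real_derivative G' x) (at x)" and G': "continuous_on UNIV G'"
  shows "abs_cont_deriv a b (\<lambda>x. G (f x)) (\<lambda>x. G' (f x) * g x)"
  unfolding abs_cont_deriv_def
proof (intro conjI allI impI)
  have cont: "continuous_on {a..b} f"
    by (rule abs_cont_deriv_continuous[OF f])
  have cont': "continuous_on {a..b} (\<lambda>x. G' (f x))"
    by (rule continuous_on_compose2[OF G' cont]) auto
  show ai: "(\<lambda>x. G' (f x) * g x) absolutely_integrable_on {a..b}"
    by (intro absolutely_integrable_mult_continuous cont' abs_cont_derivD(1)[OF f])
  fix x y assume xy: "a \<le> x" "x \<le> y" "y \<le> b"
  define D where "D c d = G (f d) - G (f c) - integral {c..d} (\<lambda>x. G' (f x) * g x)" for c d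
  have int: "(\<lambda>t. G' (f t) * g t) integrable_on {c..d}" if "a \<le> c" "d \<le> b" for c d
    using absolutely_integrable_on_subinterval[OF ai, of c d] that
    by (auto simp: absolutely_integrable_on_def)
  have D_le: "\<bar>D x y\<bar> \<le> \<epsilon> * integral {x..y} (\<lambda>t. \<bar>g t\<bar>)" if "\<epsilon> > 0" for \<epsilon>
  proof -
    have "a \<le> x \<longrightarrow> y \<le> b \<longrightarrow> \<bar>D x y\<bar> \<le> \<epsilon> * integral {x..y} (\<lambda>t. \<bar>g t\<bar>)"
      using xy(2)
    proof (induction rule: Bolzano)
      case (trans c m d)
      show ?case
      proof (intro impI)
        assume cd: "a \<le> c" "d \<le> b"
        have "D c d = D c m + D m d"
          unfolding D_def using Henstock_Kurzweil_Integration.integral_combine[OF trans(3,4) int[OF cd]] by simp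
        moreover have "integral {c..d} (\<lambda>t. \<bar>g t\<bar>) = integral {c..m} (\<lambda>t. \<bar>g t\<bar>) + integral {m..d} (\<lambda>t. \<bar>g t\<bar>)"
          using Henstock_Kurzweil_Integration.integral_combine[OF trans(3,4) abs_cont_derivD(5)[OF f cd]] by simp
        ultimately show "\<bar>D c d\<bar> \<le> \<epsilon> * integral {c..d} (\<lambda>t. \<bar>g t\<bar>)"
          using trans cd by (simp add: algebra_simps)
      qed
    next
      case (local z)
      then have z: "z \<in> {a..b}" using xy by auto
      have "isCont G' (f z)"
        using G' by (simp add: continuous_on_eq_continuous_at)
      then obtain \<eta> where \<eta>: "\<eta> > 0" "\<And>w. \<bar>w - f z\<bar> < \<eta> \<Longrightarrow> \<bar>G' w - G' (f z)\<bar> < \<epsilon> / 2"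
        using \<open>\<epsilon> > 0\<close> unfolding continuous_at_eps_delta dist_real_def by (metis half_gt_zero)
      obtain \<delta> where \<delta>: "\<delta> > 0" "\<And>t. t \<in> {a..b} \<Longrightarrow> \<bar>t - z\<bar> < \<delta> \<Longrightarrow> \<bar>f t - f z\<bar> < \<eta>"
        using cont \<eta>(1) z unfolding continuous_on_iff dist_real_def by metis
      have "\<bar>D c d\<bar> \<le> \<epsilon> * integral {c..d} (\<lambda>t. \<bar>g t\<bar>)"
        if cd: "c \<le> z" "z \<le> d" "d - c < \<delta>" "a \<le> c" "d \<le> b" for c d
      proof -
        have near: "\<bar>f t - f z\<bar> < \<eta>" if "t \<in> {c..d}" for t
          using that cd by (intro \<delta>(2)) auto
        have I: "f d - f c = integral {c..d} g"
          using cd by (intro abs_cont_derivD(2)[OF f]) auto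
        have gle: "\<bar>f d - f c\<bar> \<le> integral {c..d} (\<lambda>t. \<bar>g t\<bar>)"
          unfolding I using integral_norm_bound_integral[OF abs_cont_derivD(4)[OF f cd(4,5)] abs_cont_derivD(5)[OF f cd(4,5)]]
          by simp
        \<comment> \<open>By the mean value theorem the increment of \<open>G \<circ> f\<close> is linear up to a small error.\<close>
        have 1: "\<bar>G (f d) - G (f c) - G' (f z) * (f d - f c)\<bar> \<le> \<epsilon> / 2 * \<bar>f d - f c\<bar>"
        proof -
          have "\<bar>G v - G u - G' (f z) * (v - u)\<bar> \<le> \<epsilon> / 2 * \<bar>v - u\<bar>"
            if uv: "u < v" "\<bar>u - f z\<bar> < \<eta>" "\<bar>v - f z\<bar> < \<eta>" for u v
          proof -
            obtain w where w: "u < w" "w < v" "G v - G u = (v - u) * G' w"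
              using MVT2[OF uv(1), of G G'] G by blast
            then have "\<bar>G' w - G' (f z)\<bar> \<le> \<epsilon> / 2"
              using uv \<eta>(2)[of w] by force
            then have "\<bar>G' w - G' (f z)\<bar> * \<bar>v - u\<bar> \<le> \<epsilon> / 2 * \<bar>v - u\<bar>"
              by (intro mult_right_mono) auto
            moreover have "G v - G u - G' (f z) * (v - u) = (G' w - G' (f z)) * (v - u)"
              using w(3) by (simp add: algebra_simps)
            ultimately show ?thesis by (simp add: abs_mult)
          qed
          note * = this
          have nc: "\<bar>f c - f z\<bar> < \<eta>" "\<bar>f d - f z\<bar> < \<eta>" using near cd by auto
          show ?thesis
          proof (cases "f c" "f d" rule: linorder_cases)
            case less then show ?thesis using *[OF _ nc] by simp
          next
            case greater
            then have "\<bar>G (f c) - G (f d) - G' (f z) * (f c - f d)\<bar> \<le> \<epsilon> / 2 * \<bar>f c - f d\<bar>"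
              using *[OF _ nc(2,1)] by simp
            moreover have "G (f d) - G (f c) - G' (f z) * (f d - f c) = - (G (f c) - G (f d) - G' (f z) * (f c - f d))"
              by (simp add: algebra_simps)
            ultimately show ?thesis by (metis abs_minus_cancel abs_minus_commute)
          qed simp
        qed
        have 2: "\<bar>integral {c..d} (\<lambda>t. (G' (f z) - G' (f t)) * g t)\<bar> \<le> integral {c..d} (\<lambda>t. \<epsilon> / 2 * \<bar>g t\<bar>)"
          unfolding real_norm_def[symmetric]
        proof (rule integral_norm_bound_integral)
          show "(\<lambda>t. (G' (f z) - G' (f t)) * g t) integrable_on {c..d}"
            using integrable_diff[OF integrable_on_mult_right[OF abs_cont_derivD(4)[OF f cd(4,5)]] int[OF cd(4,5)], of "G' (f z)"]
            by (simp add: algebra_simps)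
          show "(\<lambda>t. \<epsilon> / 2 * norm (g t)) integrable_on {c..d}"
            using integrable_on_mult_right[OF abs_cont_derivD(5)[OF f cd(4,5)], of "\<epsilon>/2"] by simp
          show "norm ((G' (f z) - G' (f t)) * g t) \<le> \<epsilon> / 2 * norm (g t)" if "t \<in> {c..d}" for t
            using mult_right_mono[of "\<bar>G' (f t) - G' (f z)\<bar>" "\<epsilon> / 2" "\<bar>g t\<bar>"] \<eta>(2)[OF near[OF that]]
            by (simp add: abs_mult abs_minus_commute)
        qed
        have "D c d = (G (f d) - G (f c) - G' (f z) * (f d - f c))
            + integral {c..d} (\<lambda>t. (G' (f z) - G' (f t)) * g t)"
        proof -
          have "integral {c..d} (\<lambda>t. (G' (f z) - G' (f t)) * g t)
             = integral {c..d} (\<lambda>t. G' (f z) * g t - G' (f t) * g t)"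
            by (simp add: algebra_simps)
          also have "\<dots> = G' (f z) * integral {c..d} g - integral {c..d} (\<lambda>t. G' (f t) * g t)"
            using integrable_on_mult_right[OF abs_cont_derivD(4)[OF f cd(4,5)]] int[OF cd(4,5)]
            by (subst integral_diff) auto
          finally show ?thesis by (simp add: D_def I)
        qed
        moreover have "integral {c..d} (\<lambda>t. \<epsilon> / 2 * \<bar>g t\<bar>) = \<epsilon> / 2 * integral {c..d} (\<lambda>t. \<bar>g t\<bar>)"
          by simp
        moreover have "\<epsilon> / 2 * \<bar>f d - f c\<bar> \<le> \<epsilon> / 2 * integral {c..d} (\<lambda>t. \<bar>g t\<bar>)"
          using gle \<open>\<epsilon> > 0\<close> by (intro mult_left_mono) auto
        ultimately show ?thesis using 1 2 by linarith
      qed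
      with \<delta>(1) show ?case by blast
    qed
    with xy show ?thesis by blast
  qed
  have "\<bar>D x y\<bar> \<le> 0"
  proof (rule field_le_epsilon)
    fix e :: real assume "e > 0"
    define M where "M = integral {x..y} (\<lambda>t. \<bar>g t\<bar>)"
    have "M \<ge> 0" unfolding M_def by (rule integral_nonneg) (use abs_cont_derivD(5)[OF f] xy in auto)
    have "\<bar>D x y\<bar> \<le> e / (M + 1) * M"
      unfolding M_def by (rule D_le) (use \<open>e > 0\<close> \<open>M \<ge> 0\<close> in \<open>auto simp flip: M_def\<close>)
    also have "\<dots> \<le> e" using \<open>e > 0\<close> \<open>M \<ge> 0\<close> by (simp add: field_simps)
    finally show "\<bar>D x y\<bar> \<le> 0 + e" by simp
  qed
  then show "G (f y) - G (f x) = integral {x..y} (\<lambda>x. G' (f x) * g x)"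
    by (simp add: D_def)
qed

text \<open>
  Polarisation reduces the product rule to the chain rule for the square.
\<close>

lemma abs_cont_deriv_mult:
  assumes f: "abs_cont_deriv a b f f'" and g: "abs_cont_deriv a b g g'"
  shows "abs_cont_deriv a b (\<lambda>x. f x * g x) (\<lambda>x. f' x * g x + f x * g' x)"
proof -
  have sq: "abs_cont_deriv a b (\<lambda>x. (A * f x + B * g x)\<^sup>2)
      (\<lambda>x. 2 * (A * f x + B * g x) * (A * f' x + B * g' x))" for A B
    by (rule abs_cont_deriv_compose[OF abs_cont_deriv_lincomb[OF f g]])
       (auto intro!: derivative_eq_intros continuous_intros)
  have "(\<lambda>x. 1/4 * (1 * f x + 1 * g x)\<^sup>2 + (-1/4) * (1 * f x + (-1) * g x)\<^sup>2) = (\<lambda>x. f x * g x)"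
    by (simp add: fun_eq_iff power2_eq_square field_simps)
  moreover have "(\<lambda>x. 1/4 * (2 * (1 * f x + 1 * g x) * (1 * f' x + 1 * g' x)) +
      (-1/4) * (2 * (1 * f x + (-1) * g x) * (1 * f' x + (-1) * g' x))) = (\<lambda>x. f' x * g x + f x * g' x)"
    by (simp add: fun_eq_iff field_simps)
  ultimately show ?thesis
    using abs_cont_deriv_lincomb[OF sq[of 1 1] sq[of 1 "-1"], of "1/4" "-1/4"] by metis
qed

text \<open>
  By Lebesgue's differentiation theorem, \<open>g\<close> is almost everywhere the limit of its mean values over
  small intervals to the right.
\<close>

lemma negligible_nonzero_if_integrals_zero:
  fixes g :: "real \<Rightarrow> real"
  assumes "g integrable_on {a..b}"
    and zero: "\<And>x y. a \<le> x \<Longrightarrow> x \<le> y \<Longrightarrow> y \<le> b \<Longrightarrow> integral {x..y} g = 0"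
  shows "negligible {x \<in> {a..b}. g x \<noteq> 0}"
proof -
  define G where "G x = (if x \<in> {a..b} then g x else 0)" for x
  have GI: "G integrable_on cbox x y" for x y
  proof -
    have "g integrable_on ({a..b} \<inter> cbox x y)"
      using integrable_subinterval_real[OF assms(1), of "max a x" "min b y"]
      by (simp add: Int_atLeastAtMost)
    then show ?thesis
      unfolding G_def using integrable_restrict_Int[of "{a..b}" g "cbox x y"] by simp
  qed
  obtain N where N: "negligible N"
    "\<And>x e. \<lbrakk>x \<notin> N; 0 < e\<rbrakk> \<Longrightarrow> \<exists>d>0. \<forall>h. 0 < h \<and> h < d \<longrightarrow>
       norm (integral (cbox x (x + h *\<^sub>R One)) G /\<^sub>R h ^ DIM(real) - G x) < e"
    using integrable_ccontinuous_explicit[of G] GI by metis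
  have "g x = 0" if x: "a \<le> x" "x < b" "x \<notin> N" for x
  proof (rule ccontr)
    assume "g x \<noteq> 0"
    then obtain d where d: "d > 0" "\<And>h. 0 < h \<Longrightarrow> h < d \<Longrightarrow>
        norm (integral (cbox x (x + h *\<^sub>R One)) G /\<^sub>R h ^ DIM(real) - G x) < \<bar>g x\<bar>"
      using N(2)[OF x(3), of "\<bar>g x\<bar>"] by auto
    define h where "h = min (d / 2) (b - x)"
    have h: "0 < h" "h < d" "x + h \<le> b" using d x by (auto simp: h_def)
    have "integral {x..x + h} G = integral {x..x + h} g"
      by (rule integral_cong) (use h x in \<open>auto simp: G_def\<close>)
    also have "\<dots> = 0" using h x by (intro zero) auto
    finally show False using d(2)[OF h(1,2)] x by (simp add: G_def)
  qed
  then have "{x \<in> {a..b}. g x \<noteq> 0} \<subseteq> insert b N"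
    by force
  then show ?thesis
    using N(1) by (meson negligible_insert negligible_subset)
qed

lemma abs_cont_deriv_unique:
  assumes f: "abs_cont_deriv a b f g" and h: "abs_cont_deriv a b f h"
  shows "negligible {x \<in> {a..b}. g x \<noteq> h x}"
proof -
  have *: "abs_cont_deriv a b (\<lambda>x. 0) (\<lambda>x. g x - h x)"
    using abs_cont_deriv_lincomb[OF f h, of 1 "-1"] by (simp add: algebra_simps)
  show ?thesis
    using negligible_nonzero_if_integrals_zero[OF abs_cont_derivD(4)[OF * order_refl order_refl]]
      abs_cont_derivD(2)[OF *, symmetric] by simp
qed

section \<open>Continuous functions with a weak derivative\<close>

text \<open>
  The functions \<open>n * deriv S (n * (x - c))\<close> are an approximate identity at \<open>c\<close> that sees only points to
  the right of \<open>c\<close>.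
\<close>

lemma rescaled_kernel_tendsto:
  fixes f S :: "real \<Rightarrow> real"
  assumes S: "smooth S" "\<And>x. x \<le> 0 \<Longrightarrow> S x = 0" "\<And>x. 1 \<le> x \<Longrightarrow> S x = 1" "\<And>x. 0 \<le> deriv S x"
      "\<And>x. x \<le> 0 \<or> 1 \<le> x \<Longrightarrow> deriv S x = 0"
    and f: "continuous_on {c..b} f" and "c < b"
  shows "(\<lambda>n. integral {c..b} (\<lambda>x. f x * (real n * deriv S (real n * (x - c))))) \<longlonglongrightarrow> f c"
proof (rule LIMSEQ_I)
  fix r :: real assume "r > 0"
  obtain d where d: "d > 0" "\<And>x. x \<in> {c..b} \<Longrightarrow> \<bar>x - c\<bar> < d \<Longrightarrow> \<bar>f x - f c\<bar> < r / 2"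
    using f \<open>r > 0\<close> \<open>c < b\<close> unfolding continuous_on_iff dist_real_def
    by (metis atLeastAtMost_iff half_gt_zero less_eq_real_def)
  obtain N where N: "real N > 1 / d" "real N > 1 / (b - c)"
    using reals_Archimedean2[of "max (1 / d) (1 / (b - c))"] by auto
  have dS_cont: "continuous_on A (\<lambda>x. deriv S (real n * (x - c)))" for A n
    by (rule continuous_on_compose2[OF smooth_imp_continuous[OF smooth_has_deriv(2)[OF S(1)], of UNIV]])
       (auto intro!: continuous_intros)
  show "\<exists>no. \<forall>n\<ge>no. norm (integral {c..b} (\<lambda>x. f x * (real n * deriv S (real n * (x - c)))) - f c) < r"
  proof (intro exI allI impI)
    fix n assume "N \<le> n"
    then have n: "real n > 1 / d" "real n > 1 / (b - c)" using N by linarith+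
    have "n > 0" using n(1) d(1) by (metis gr0I less_asym of_nat_0 zero_less_divide_1_iff)
    define k where "k x = real n * deriv S (real n * (x - c))" for x
    have k_nonneg: "k x \<ge> 0" for x using S(4) by (simp add: k_def)
    have k_cont: "continuous_on {c..b} k"
      unfolding k_def by (intro continuous_intros dS_cont)
    have "((\<lambda>x. S (real n * (x - c))) has_vector_derivative k x) (at x within {c..b})" for x
      unfolding has_real_derivative_iff_has_vector_derivative[symmetric] k_def
      by (rule has_field_derivative_at_within)
         (rule smooth_rescale_has_deriv[OF S(1)])
    then have "(k has_integral S (real n * (b - c)) - S (real n * (c - c))) {c..b}"
      using \<open>c < b\<close> by (intro fundamental_theorem_of_calculus) auto
    moreover have "1 \<le> real n * (b - c)" using n(2) \<open>c < b\<close> by (simp add: field_simps)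
    ultimately have k_int: "(k has_integral 1) {c..b}" by (simp add: S)
    have fk_int: "(\<lambda>x. f x * k x) integrable_on {c..b}"
      by (intro integrable_continuous_real continuous_intros f k_cont)
    \<comment> \<open>The kernel \<open>k\<close> has mass one and is concentrated on \<open>{c..c + 1 / n}\<close>.\<close>
    have bound: "norm ((f x - f c) * k x) \<le> r / 2 * k x" if "x \<in> {c..b}" for x
    proof (cases "x - c < d")
      case True
      then have "\<bar>f x - f c\<bar> \<le> r / 2" using d(2)[OF that] that by force
      then have "\<bar>f x - f c\<bar> * k x \<le> r / 2 * k x" by (rule mult_right_mono[OF _ k_nonneg])
      then show ?thesis using k_nonneg[of x] by (simp add: abs_mult)
    next
      case False
      have "1 < real n * d" using n(1) d(1) by (simp add: field_simps)
      also have "\<dots> \<le> real n * (x - c)" using False by (intro mult_left_mono) auto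
      finally have gt: "1 < real n * (x - c)" .
      then show ?thesis by (simp add: k_def S(5))
    qed
    have "norm (integral {c..b} (\<lambda>x. (f x - f c) * k x)) \<le> integral {c..b} (\<lambda>x. r / 2 * k x)"
      using k_int by (intro integral_norm_bound_integral bound)
        (auto intro!: integrable_continuous_real continuous_intros f k_cont)
    also have "\<dots> = r / 2" using integral_unique[OF k_int] by simp
    finally have "\<bar>integral {c..b} (\<lambda>x. (f x - f c) * k x)\<bar> \<le> r / 2" by simp
    moreover have "integral {c..b} (\<lambda>x. (f x - f c) * k x) = integral {c..b} (\<lambda>x. f x * k x) - f c"
    proof -
      have "integral {c..b} (\<lambda>x. f x * k x - f c * k x) = integral {c..b} (\<lambda>x. f x * k x) - integral {c..b} (\<lambda>x. f c * k x)"
        by (intro integral_diff fk_int) (auto intro!: integrable_continuous_real continuous_intros k_cont)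
      then show ?thesis using integral_unique[OF k_int] by (simp add: left_diff_distrib)
    qed
    ultimately show "norm (integral {c..b} (\<lambda>x. f x * (real n * deriv S (real n * (x - c)))) - f c) < r"
      using \<open>r > 0\<close> by (simp add: k_def)
  qed
qed

text \<open>
  The test function \<open>S (n * (x - s)) - S (n * (x - t))\<close> tends to the indicator function of \<open>{s<..t}\<close>,
  while its derivative is a difference of approximate identities at \<open>s\<close> and \<open>t\<close>.
\<close>

lemma weak_deriv_on_increment:
  assumes w: "weak_deriv_on I f g" and f: "continuous_on I f"
    and I: "open I" "{s..t} \<subseteq> I" and "s \<le> t"
  shows "integral {s..t} g = f t - f s"
proof (cases "s = t")
  case False
  with \<open>s \<le> t\<close> have "s < t" by simp
  obtain S where S: "smooth S" "\<And>x. x \<le> 0 \<Longrightarrow> S x = 0" "\<And>x. 1 \<le> x \<Longrightarrow> S x = 1"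
    "\<And>x. 0 \<le> deriv S x" "\<And>x. x \<le> 0 \<or> 1 \<le> x \<Longrightarrow> deriv S x = 0"
    using smooth_step_exists by blast
  have S_mono: "S x \<le> S y" if "x \<le> y" for x y
    using that by (rule DERIV_nonneg_imp_nondecreasing) (use smooth_has_deriv(1)[OF S(1)] S(4) in blast)
  have S_range: "0 \<le> S x" "S x \<le> 1" for x
    using S_mono[of 0 x] S_mono[of x 1] S(2)[of x] S(3)[of x] S(2)[of 0] S(3)[of 1] by linarith+
  have "t \<in> I" using I \<open>s \<le> t\<close> by auto
  then obtain e where e: "e > 0" "cball t e \<subseteq> I"
    using I(1) open_contains_cball by blast
  define b where "b = t + e"
  have sb: "{s..b} \<subseteq> I"
  proof
    fix x assume "x \<in> {s..b}"
    then show "x \<in> I" using I(2) e by (cases "x \<le> t") (auto simp: b_def dist_real_def subset_iff)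
  qed
  have b: "s < b" "t < b" using \<open>s < t\<close> e by (auto simp: b_def)
  have g_int: "g absolutely_integrable_on {s..b}"
    using w sb by (auto simp: weak_deriv_on_def locally_L1_def)
  define \<psi> where "\<psi> n x = S (real n * (x - s)) - S (real n * (x - t))" for n x
  define k where "k c n x = real n * deriv S (real n * (x - c))" for c n x
  have d\<psi>: "deriv (\<psi> n) x = k s n x - k t n x" for n x
    unfolding \<psi>_def k_def
    by (intro DERIV_imp_deriv derivative_intros smooth_rescale_has_deriv S(1))
  have \<psi>_cont: "continuous_on A (\<psi> n)" for A n
    unfolding \<psi>_def
    by (intro continuous_intros continuous_on_compose2[OF smooth_imp_continuous[OF S(1), of UNIV]]) auto
  have k_cont: "continuous_on A (k c n)" for A c n
    unfolding k_def
    by (intro continuous_intros continuous_on_compose2[OF smooth_imp_continuous[OF smooth_has_deriv(2)[OF S(1)], of UNIV]]) auto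
  obtain N where N: "real N > 1 / e" using reals_Archimedean2 by blast
  have test: "test_fun I (\<psi> n)" and \<psi>_supp: "\<And>x. x \<notin> {s..b} \<Longrightarrow> \<psi> n x = 0"
    and d\<psi>_supp: "\<And>x. x \<notin> {s..b} \<Longrightarrow> deriv (\<psi> n) x = 0" if "N \<le> n" for n
  proof -
    have n: "real n * e > 1" using N that e by (simp add: field_simps) (smt (verit) mult_left_mono of_nat_mono)
    have "smooth (\<psi> n)"
      unfolding \<psi>_def using smooth_diff[OF smooth_affine[OF S(1), of 1 "real n" "- real n * s"] smooth_affine[OF S(1), of 1 "real n" "- real n * t"]]
      by (simp add: right_diff_distrib)
    have out: "(real n * (x - s) \<le> 0 \<and> real n * (x - t) \<le> 0) \<or> (1 \<le> real n * (x - s) \<and> 1 \<le> real n * (x - t))"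
      if "x \<notin> {s..b}" for x
    proof (cases "x < s")
      case True
      with \<open>s < t\<close> show ?thesis by (auto intro!: mult_nonneg_nonpos)
    next
      case False
      then have "e \<le> x - t" "e \<le> x - s" using that \<open>s < t\<close> by (auto simp: b_def)
      then have "real n * e \<le> real n * (x - t)" "real n * e \<le> real n * (x - s)"
        by (auto intro!: mult_left_mono)
      with n show ?thesis by linarith
    qed
    show supp: "\<psi> n x = 0" if "x \<notin> {s..b}" for x
      using out[OF that] by (auto simp: \<psi>_def S(2,3))
    show "deriv (\<psi> n) x = 0" if "x \<notin> {s..b}" for x
      using out[OF that] by (auto simp: d\<psi> k_def S(5))
    show "test_fun I (\<psi> n)"
      unfolding test_fun_def
      using \<open>smooth (\<psi> n)\<close> sb supp by (auto simp: smooth_def intro!: exI[of _ "{s..b}"])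
  qed
  have restrict: "(LINT x:I|lebesgue. u x) = integral {s..b} u"
    if "u absolutely_integrable_on {s..b}" "\<And>x. x \<notin> {s..b} \<Longrightarrow> u x = 0" for u :: "real \<Rightarrow> real"
  proof -
    have "(LINT x:I|lebesgue. u x) = (LINT x:{s..b}|lebesgue. u x)"
      unfolding set_lebesgue_integral_def
      by (rule Bochner_Integration.integral_cong)
         (use that(2) sb in \<open>auto simp: indicator_def\<close>)
    then show ?thesis using set_lebesgue_integral_eq_integral(2)[OF that(1)] by simp
  qed
  have f_cont: "continuous_on {s..b} f" using f sb continuous_on_subset by blast
  \<comment> \<open>Testing with \<open>\<psi> n\<close>, a smooth approximation of the indicator function of \<open>{s<..t}\<close>.\<close>
  have eq: "integral {s..b} (\<lambda>x. f x * k s n x) - integral {t..b} (\<lambda>x. f x * k t n x)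
      = - integral {s..b} (\<lambda>x. \<psi> n x * g x)" if n: "N \<le> n" for n
  proof -
    have fk: "(\<lambda>x. f x * k c n x) integrable_on {a'..b}" if "s \<le> a'" for c a'
      using that by (intro integrable_continuous_real continuous_intros k_cont continuous_on_subset[OF f_cont]) auto
    have "integral {s..b} (\<lambda>x. f x * k t n x) = integral {s..t} (\<lambda>x. f x * k t n x) + integral {t..b} (\<lambda>x. f x * k t n x)"
      using \<open>s < t\<close> b by (intro Henstock_Kurzweil_Integration.integral_combine[symmetric] fk) auto
    also have "integral {s..t} (\<lambda>x. f x * k t n x) = integral {s..t} (\<lambda>x. 0)"
      by (rule integral_cong) (auto simp: k_def mult_nonneg_nonpos intro!: S(5))
    finally have 1: "integral {s..b} (\<lambda>x. f x * k t n x) = integral {t..b} (\<lambda>x. f x * k t n x)" by simp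
    have "(LINT x:I|lebesgue. f x * deriv (\<psi> n) x) = integral {s..b} (\<lambda>x. f x * deriv (\<psi> n) x)"
    proof (rule restrict)
      show "(\<lambda>x. f x * deriv (\<psi> n) x) absolutely_integrable_on {s..b}"
        unfolding d\<psi> by (intro absolutely_integrable_continuous_real continuous_intros f_cont k_cont)
    qed (simp add: d\<psi>_supp[OF n])
    also have "\<dots> = integral {s..b} (\<lambda>x. f x * k s n x) - integral {s..b} (\<lambda>x. f x * k t n x)"
      unfolding d\<psi> right_diff_distrib by (intro integral_diff fk) auto
    finally have 2: "(LINT x:I|lebesgue. f x * deriv (\<psi> n) x) =
        integral {s..b} (\<lambda>x. f x * k s n x) - integral {t..b} (\<lambda>x. f x * k t n x)" using 1 by simp
    have "(LINT x:I|lebesgue. g x * \<psi> n x) = integral {s..b} (\<lambda>x. g x * \<psi> n x)"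
    proof (rule restrict)
      show "(\<lambda>x. g x * \<psi> n x) absolutely_integrable_on {s..b}"
        using absolutely_integrable_mult_continuous[OF \<psi>_cont g_int] by (simp add: mult.commute)
    qed (simp add: \<psi>_supp[OF n])
    with 2 show ?thesis
      using w test[OF n] by (simp add: weak_deriv_on_def mult.commute)
  qed
  have lim: "(\<lambda>n. integral {s..b} (\<lambda>x. \<psi> n x * g x)) \<longlonglongrightarrow> integral {s..b} (\<lambda>x. if x \<in> {s<..t} then g x else 0)"
  proof (rule dominated_convergence(2))
    show "(\<lambda>x. \<psi> n x * g x) integrable_on {s..b}" for n
      using absolutely_integrable_mult_continuous[OF \<psi>_cont g_int] by (auto simp: absolutely_integrable_on_def)
    show "(\<lambda>x. \<bar>g x\<bar>) integrable_on {s..b}" using g_int by (auto simp: absolutely_integrable_on_def)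
    show "norm (\<psi> n x * g x) \<le> \<bar>g x\<bar>" for n x
    proof -
      have "\<bar>\<psi> n x\<bar> \<le> 1"
        using S_range[of "real n * (x - s)"] S_range[of "real n * (x - t)"] by (simp add: \<psi>_def)
      then show ?thesis using mult_right_mono[of "\<bar>\<psi> n x\<bar>" 1 "\<bar>g x\<bar>"] by (simp add: abs_mult)
    qed
    fix x assume "x \<in> {s..b}"
    have neg: "S (real n * y) = 0" if "y \<le> 0" for y n
      using that by (intro S(2)) (simp add: mult_nonneg_nonpos)
    have pos: "(\<lambda>n. S (real n * y)) \<longlonglongrightarrow> 1" if "y > 0" for y
    proof (rule tendsto_eventually)
      obtain M where M: "real M > 1 / y" using reals_Archimedean2 by blast
      have "S (real n * y) = 1" if "n \<ge> M" for n
      proof (rule S(3))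
        have "1 < real M * y" using M \<open>y > 0\<close> by (simp add: field_simps)
        also have "\<dots> \<le> real n * y" using that \<open>y > 0\<close> by simp
        finally show "1 \<le> real n * y" by simp
      qed
      then show "eventually (\<lambda>n. S (real n * y) = 1) sequentially"
        by (rule eventually_sequentiallyI)
    qed
    have "(\<lambda>n. \<psi> n x) \<longlonglongrightarrow> (if x \<in> {s<..t} then 1 else 0)"
    proof -
      consider "x \<le> s" | "s < x" "x \<le> t" | "t < x" by linarith
      then show ?thesis
      proof cases
        case 1 with \<open>s < t\<close> show ?thesis by (simp add: \<psi>_def neg)
      next
        case 2 then show ?thesis using pos[of "x - s"] by (simp add: \<psi>_def neg)
      next
        case 3 then show ?thesis
          using tendsto_diff[OF pos[of "x - s"] pos[of "x - t"]] \<open>s < t\<close> by (simp add: \<psi>_def)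
      qed
    qed
    from tendsto_mult[OF this tendsto_const[of "g x"]]
    show "(\<lambda>n. \<psi> n x * g x) \<longlonglongrightarrow> (if x \<in> {s<..t} then g x else 0)"
      by (simp only: if_distrib[of "\<lambda>z. z * g x"] mult_1 mult_zero_left)
  qed
  have "integral {s..b} (\<lambda>x. if x \<in> {s<..t} then g x else 0) = integral {s<..t} g"
  proof -
    have "{s<..t} \<inter> {s..b} = {s<..t}" using b by auto
    then show ?thesis using integral_restrict_Int[of "{s..b}" "{s<..t}" g] by simp
  qed
  also have "\<dots> = integral {s..t} g"
    by (rule integral_spike_set) (rule negligible_subset[of "{s}"]; auto)+
  finally have int_eq: "integral {s..b} (\<lambda>x. if x \<in> {s<..t} then g x else 0) = integral {s..t} g" .
  have "(\<lambda>n. integral {s..b} (\<lambda>x. f x * k s n x) - integral {t..b} (\<lambda>x. f x * k t n x)) \<longlonglongrightarrow> f s - f t"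
    unfolding k_def
    by (intro tendsto_diff rescaled_kernel_tendsto S b f_cont continuous_on_subset[OF f_cont])
       (use \<open>s < t\<close> in auto)
  moreover have "(\<lambda>n. integral {s..b} (\<lambda>x. f x * k s n x) - integral {t..b} (\<lambda>x. f x * k t n x)) \<longlonglongrightarrow> - integral {s..t} g"
    using eq by (intro Lim_transform_eventually[OF tendsto_minus[OF lim[unfolded int_eq]]])
      (auto intro!: eventually_sequentiallyI[of N])
  ultimately have "f s - f t = - integral {s..t} g" by (rule LIMSEQ_unique)
  then show ?thesis by simp
qed simp

lemma weak_deriv_on_abs_cont_deriv:
  assumes w: "weak_deriv_on I f g" and f: "continuous_on I f"
    and I: "open I" "{s..t} \<subseteq> I"
  shows "abs_cont_deriv s t f g"
  unfolding abs_cont_deriv_def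
proof (intro conjI allI impI)
  show "g absolutely_integrable_on {s..t}"
    using w I by (auto simp: weak_deriv_on_def locally_L1_def)
  show "f y - f x = integral {x..y} g" if "s \<le> x" "x \<le> y" "y \<le> t" for x y
  proof -
    have "{x..y} \<subseteq> I" using that I(2) by auto
    then show ?thesis using weak_deriv_on_increment[OF w f I(1)] that by simp
  qed
qed

lemma negligible_on_einterval:
  assumes "\<And>s t. 0 < s \<Longrightarrow> s < t \<Longrightarrow> ereal t < R \<Longrightarrow> negligible {x \<in> {s..t}. P x}"
  shows "negligible {x \<in> einterval 0 R. P x}"
proof (subst locally_negligible_alt, rule)
  fix x assume x: "x \<in> {x \<in> einterval 0 R. P x}"
  then have "ereal x < R" "0 < x" by (auto simp: einterval_iff)
  then obtain t where t: "x < t" "ereal t < R"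
    using ereal_dense2[of "ereal x" R] by auto
  let ?U = "{x \<in> einterval 0 R. P x} \<inter> {x / 2<..<t}"
  have "negligible ?U"
    by (rule negligible_subset[OF assms[of "x/2" t]]) (use t \<open>0 < x\<close> in auto)
  moreover have "openin (top_of_set {x \<in> einterval 0 R. P x}) ?U"
    by (intro openin_open_Int) auto
  ultimately show "\<exists>U. openin (top_of_set {x \<in> einterval 0 R. P x}) U \<and> x \<in> U \<and> negligible U"
    using x t \<open>0 < x\<close> by (intro exI[of _ ?U]) auto
qed

lemma half_open_Icc: "ereal r < R \<Longrightarrow> {0..r} \<subseteq> half_open R"
  by (auto simp: half_open_def) (meson ereal_less_eq(3) le_less_trans)

lemma einterval_subset_half_open: "einterval 0 R \<subseteq> half_open R"
  by (auto simp: half_open_def einterval_iff)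

lemma einterval_Icc: "0 < s \<Longrightarrow> ereal t < R \<Longrightarrow> {s..t} \<subseteq> einterval 0 R"
  by (auto simp: einterval_iff) (meson ereal_less_eq(3) le_less_trans)

lemma abs_cont_deriv_cong_ae:
  assumes f: "abs_cont_deriv a b f g" and N: "negligible N" "\<And>x. x \<in> {a..b} - N \<Longrightarrow> h x = g x"
  shows "abs_cont_deriv a b f h"
  unfolding abs_cont_deriv_def
proof (intro conjI allI impI)
  show "h absolutely_integrable_on {a..b}"
    by (rule absolutely_integrable_spike[OF abs_cont_derivD(1)[OF f] N])
  fix x y assume xy: "a \<le> x" "x \<le> y" "y \<le> b"
  have "integral {x..y} g = integral {x..y} h"
    by (rule integral_spike[OF N(1)]) (use N(2) xy in auto)
  then show "f y - f x = integral {x..y} h"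
    using abs_cont_derivD(2)[OF f xy] by simp
qed

text \<open>
  The increments of the indefinite integral of \<open>g\<close> agree with those of \<open>f\<close> in the open interval, and by
  continuity also up to the end points.
\<close>

lemma abs_cont_deriv_closed_interval:
  assumes f_cont: "continuous_on {0..r} f" and g_int: "g absolutely_integrable_on {0..r}"
    and loc: "\<And>s t. 0 < s \<Longrightarrow> s \<le> t \<Longrightarrow> t < r \<Longrightarrow> abs_cont_deriv s t f g" and "0 < r"
  shows "abs_cont_deriv 0 r f g"
proof -
  define H where "H x = f x - integral {0..x} g" for x
  have gi: "g integrable_on {0..x}" if "x \<le> r" for x
    using absolutely_integrable_on_subinterval[OF g_int, of 0 x] that
    by (auto simp: absolutely_integrable_on_def)
  have H_cont: "continuous_on {0..r} H"
    unfolding H_def by (intro continuous_intros f_cont indefinite_integral_continuous_1 gi) auto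
  have H_le: "H y = H x" if "0 < x" "x \<le> y" "y < r" for x y
  proof -
    have "f y - f x = integral {x..y} g"
      using abs_cont_derivD(2)[OF loc[OF that]] that by auto
    moreover have "integral {0..x} g + integral {x..y} g = integral {0..y} g"
      using that by (intro Henstock_Kurzweil_Integration.integral_combine gi) auto
    ultimately show ?thesis by (simp add: H_def)
  qed
  have H_eq: "H y = H (r / 2)" if "0 < y" "y < r" for y
    using H_le[of y "r/2"] H_le[of "r/2" y] that \<open>0 < r\<close> by (cases "y \<le> r / 2") auto
  have H_closure: "H y = H (r / 2)" if "y \<in> closure {0<..<r}" for y
  proof (rule continuous_constant_on_closure[OF _ _ that])
    show "continuous_on (closure {0<..<r}) H" using H_cont \<open>0 < r\<close> by simp
    show "H x = H (r / 2)" if "x \<in> {0<..<r}" for x using that by (intro H_eq) auto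
  qed
  have H: "H y = H (r / 2)" if "0 \<le> y" "y \<le> r" for y
    by (rule H_closure) (use that  \<open>0 < r\<close> in simp)
  show ?thesis
    unfolding abs_cont_deriv_def
  proof (intro conjI allI impI g_int)
    fix x y assume xy: "0 \<le> x" "x \<le> y" "y \<le> r"
    have "integral {0..x} g + integral {x..y} g = integral {0..y} g"
      using xy by (intro Henstock_Kurzweil_Integration.integral_combine gi) auto
    then show "f y - f x = integral {x..y} g"
      using H[of x] H[of y] xy by (simp add: H_def)
  qed
qed

text \<open>
  The space provides a weak derivative that is integrable up to the origin, but possibly a different
  one for every \<open>r\<close>. Uniqueness almost everywhere then transfers integrability to a given weak
  derivative on \<open>(0,R)\<close> (\<open>W11_loc_half_open_abs_cont_deriv\<close>).
\<close>

lemma W11_loc_half_open_ex_abs_cont_deriv: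
  assumes f: "W11_loc_half_open R f" and r: "0 < r" "ereal r < R"
  obtains g where "abs_cont_deriv 0 r f g"
proof -
  have f_cont: "continuous_on {0..r} f"
    using f half_open_Icc[OF r(2)] continuous_on_subset by (auto simp: W11_loc_half_open_def)
  obtain g where g: "g absolutely_integrable_on {0<..<r}" "weak_deriv_on {0<..<r} f g"
    using f r by (auto simp: W11_loc_half_open_def sobolev_W11_def)
  have "abs_cont_deriv 0 r f g"
  proof (rule abs_cont_deriv_closed_interval[OF f_cont _ _ r(1)])
    show "g absolutely_integrable_on {0..r}"
      using g(1) by (simp add: absolutely_integrable_on_Icc_iff_Ioo)
    show "abs_cont_deriv s t f g" if "0 < s" "s \<le> t" "t < r" for s t
      using that by (intro weak_deriv_on_abs_cont_deriv[OF g(2)] continuous_on_subset[OF f_cont]) auto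
  qed
  then show ?thesis by (rule that)
qed

lemma abs_cont_deriv_einterval:
  assumes "continuous_on (half_open R) f" "weak_deriv_on (einterval 0 R) f g" "0 < s" "ereal t < R"
  shows "abs_cont_deriv s t f g"
  using assms einterval_Icc[OF assms(3,4)] einterval_subset_half_open[of R]
  by (intro weak_deriv_on_abs_cont_deriv[OF assms(2)] continuous_on_subset[OF assms(1)]) auto

lemma weak_deriv_on_ae_unique:
  assumes f: "continuous_on (half_open R) f" "weak_deriv_on (einterval 0 R) f g"
    and h: "abs_cont_deriv 0 r f h" and r: "ereal r < R"
  shows "negligible {x \<in> {0..r}. g x \<noteq> h x}"
proof -
  have "negligible {x \<in> einterval 0 (ereal r). g x \<noteq> h x}"
  proof (rule negligible_on_einterval)
    fix s t assume st: "0 < s" "s < t" "ereal t < ereal r"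
    then have "ereal t < R" using r by (meson less_trans)
    with st show "negligible {x \<in> {s..t}. g x \<noteq> h x}"
      by (intro abs_cont_deriv_unique[OF abs_cont_deriv_einterval[OF f] abs_cont_deriv_subinterval[OF h]]) auto
  qed
  then have "negligible ({x \<in> einterval 0 (ereal r). g x \<noteq> h x} \<union> {0, r})"
    by (intro negligible_Un) auto
  then show ?thesis
    by (rule negligible_subset) (auto simp: einterval_iff less_le)
qed

lemma W11_loc_half_open_abs_cont_deriv:
  assumes f: "W11_loc_half_open R f" and w: "weak_deriv_on (einterval 0 R) f g"
    and r: "0 < r" "ereal r < R"
  shows "abs_cont_deriv 0 r f g"
proof -
  have fc: "continuous_on (half_open R) f"
    using f by (simp add: W11_loc_half_open_def)
  obtain h where h: "abs_cont_deriv 0 r f h"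
    using W11_loc_half_open_ex_abs_cont_deriv[OF f r] .
  show ?thesis
    by (rule abs_cont_deriv_cong_ae[OF h weak_deriv_on_ae_unique[OF fc w h r(2)]]) auto
qed

section \<open>Signed powers\<close>

text \<open>
  For \<open>c = p - 1\<close> this is \<open>Phi_p\<close>. Unlike the family \<open>Phi_p\<close> it is indexed so that the inverse function has
  the reciprocal index.
\<close>

definition signed_powr :: "real \<Rightarrow> real \<Rightarrow> real" where
  "signed_powr c x = sgn x * \<bar>x\<bar> powr c"

lemma signed_powr_0 [simp]: "signed_powr c 0 = 0"
  by (simp add: signed_powr_def)

lemma Phi_p_eq_signed_powr: "Phi_p p x = signed_powr (p - 1) x"
proof (cases "x = 0")
  case False
  have "\<bar>x\<bar> powr (p - 1) = \<bar>x\<bar> powr (p - 2) * \<bar>x\<bar>"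
    using False powr_add[of "\<bar>x\<bar>" "p - 2" 1] by simp
  then show ?thesis using False
    by (cases x "0::real" rule: linorder_cases) (auto simp: Phi_p_def signed_powr_def)
qed (simp add: Phi_p_def signed_powr_def)

lemma abs_signed_powr: "\<bar>signed_powr c x\<bar> = \<bar>x\<bar> powr c"
  by (simp add: signed_powr_def abs_mult abs_sgn_eq)

lemma signed_powr_inverse: "c > 0 \<Longrightarrow> signed_powr (1 / c) (signed_powr c x) = x"
  by (auto simp: signed_powr_def abs_mult powr_powr sgn_mult abs_sgn_eq sgn_mult_abs)

lemma continuous_signed_powr:
  assumes "c > 0" shows "continuous_on A (signed_powr c)"
proof -
  have "isCont (signed_powr c) x" for x
  proof (cases "x = 0")
    case True
    have "((\<lambda>y::real. \<bar>y\<bar> powr c) \<longlongrightarrow> \<bar>0\<bar> powr c) (at 0)"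
      using assms by (intro tendsto_powr' tendsto_intros) (auto intro: always_eventually)
    then have "((\<lambda>y. \<bar>signed_powr c y\<bar>) \<longlongrightarrow> 0) (at 0)"
      by (simp add: abs_signed_powr)
    then have "(signed_powr c \<longlongrightarrow> 0) (at 0)"
      by (rule tendsto_rabs_zero_cancel)
    then show ?thesis using True by (simp add: isCont_def signed_powr_def)
  next
    case False
    then show ?thesis unfolding signed_powr_def by (intro continuous_intros) auto
  qed
  then show ?thesis by (simp add: continuous_at_imp_continuous_on)
qed

lemma abs_powr_has_deriv:
  assumes "c > 1"
  shows "((\<lambda>x. \<bar>x\<bar> powr c) has_real_derivative c * signed_powr (c - 1) x) (at x)"
proof (cases x "0::real" rule: linorder_cases)
  case equal
  have "((\<lambda>h. signed_powr (c - 1) h) \<longlongrightarrow> 0) (at 0)"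
  proof -
    have "isCont (signed_powr (c - 1)) 0"
      using continuous_signed_powr[of "c - 1" UNIV] assms by (simp add: continuous_on_eq_continuous_at)
    then show ?thesis by (simp add: isCont_def)
  qed
  moreover have quot: "signed_powr (c - 1) h = \<bar>h\<bar> powr c / h" for h
    using powr_diff[of "\<bar>h\<bar>" c 1] by (cases h "0::real" rule: linorder_cases) (auto simp: signed_powr_def)
  moreover have "signed_powr (c - 1) = (\<lambda>h. \<bar>h\<bar> powr c / h)"
    by (rule ext) (rule quot)
  ultimately have "((\<lambda>h. \<bar>h\<bar> powr c / h) \<longlongrightarrow> 0) (at 0)"
    by metis
  then show ?thesis using equal by (simp add: DERIV_def)
next
  case less
  have "eventually (\<lambda>y. \<bar>y\<bar> powr c = (- y) powr c) (nhds x)"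
    using eventually_nhds_in_open[of "{..<0}" x] less by (auto elim: eventually_mono)
  moreover have "((\<lambda>y. (- y) powr c) has_real_derivative c * signed_powr (c - 1) x) (at x)"
    using less by (auto intro!: derivative_eq_intros simp: signed_powr_def powr_diff)
  ultimately show ?thesis by (subst DERIV_cong_ev[OF refl _ refl])
next
  case greater
  have "eventually (\<lambda>y. \<bar>y\<bar> powr c = y powr c) (nhds x)"
    using eventually_nhds_in_open[of "{0<..}" x] greater by (auto elim: eventually_mono)
  moreover have "((\<lambda>y. y powr c) has_real_derivative c * signed_powr (c - 1) x) (at x)"
    using greater by (auto intro!: derivative_eq_intros simp: signed_powr_def powr_diff)
  ultimately show ?thesis by (subst DERIV_cong_ev[OF refl _ refl])
qed

lemma continuous_on_abs_powr:
  fixes f :: "real \<Rightarrow> real"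
  assumes "continuous_on A f" "c > 0"
  shows "continuous_on A (\<lambda>x. \<bar>f x\<bar> powr c)"
  using assms by (intro continuous_on_powr' continuous_intros) auto

section \<open>The Hoelder and Opial inequalities\<close>

lemma integral_le_off_negligible:
  fixes f g :: "real \<Rightarrow> real"
  assumes "f integrable_on S" "g integrable_on S" "negligible N" "\<And>x. x \<in> S - N \<Longrightarrow> f x \<le> g x"
  shows "integral S f \<le> integral S g"
proof -
  let ?f = "\<lambda>x. if x \<in> N then g x else f x"
  have "?f integrable_on S"
    by (rule integrable_spike[OF assms(1,3)]) auto
  then have "integral S ?f \<le> integral S g"
    by (rule integral_le) (use assms in auto)
  moreover have "integral S ?f = integral S f"
    by (rule integral_spike[OF assms(3)]) auto
  ultimately show ?thesis by simp
qed

text \<open>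
  The weighted inequality of arithmetic and geometric means, applied to \<open>A\<close> and \<open>B\<close> divided by their
  integrals.
\<close>

lemma integral_Holder_powr:
  fixes A B F :: "real \<Rightarrow> real"
  assumes A: "A integrable_on S" "\<And>x. x \<in> S - N \<Longrightarrow> 0 \<le> A x"
    and B: "B integrable_on S" "\<And>x. x \<in> S - N \<Longrightarrow> 0 \<le> B x"
    and F: "F integrable_on S" and N: "negligible N"
    and le: "\<And>x. x \<in> S - N \<Longrightarrow> F x \<le> A x powr \<alpha> * B x powr \<beta>"
    and ab: "0 < \<alpha>" "0 < \<beta>" "\<alpha> + \<beta> = 1"
  shows "integral S F \<le> integral S A powr \<alpha> * integral S B powr \<beta>"
proof -
  define X where "X = integral S A"
  define Y where "Y = integral S B"
  have X: "0 \<le> X" using integral_le_off_negligible[OF integrable_0 A(1) N] A(2) by (simp add: X_def)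
  have Y: "0 \<le> Y" using integral_le_off_negligible[OF integrable_0 B(1) N] B(2) by (simp add: Y_def)
  \<comment> \<open>Shifting both integrals by \<open>\<epsilon>\<close> keeps the normalising divisions away from zero.\<close>
  have "integral S F \<le> (X + \<epsilon>) powr \<alpha> * (Y + \<epsilon>) powr \<beta>" if e: "\<epsilon> > 0" for \<epsilon>
  proof -
    define C where "C = (X + \<epsilon>) powr \<alpha> * (Y + \<epsilon>) powr \<beta>"
    have "F x \<le> C * (\<alpha> * (A x / (X + \<epsilon>)) + \<beta> * (B x / (Y + \<epsilon>)))" if x: "x \<in> S - N" for x
    proof -
      have "A x powr \<alpha> * B x powr \<beta> = C * ((A x / (X + \<epsilon>)) powr \<alpha> * (B x / (Y + \<epsilon>)) powr \<beta>)"
        using X Y e A(2)[of x] B(2)[of x] x by (simp add: C_def powr_divide)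
      also have "\<dots> \<le> C * (\<alpha> * (A x / (X + \<epsilon>)) + \<beta> * (B x / (Y + \<epsilon>)))"
      proof (rule mult_left_mono)
        show "(A x / (X + \<epsilon>)) powr \<alpha> * (B x / (Y + \<epsilon>)) powr \<beta> \<le> \<alpha> * (A x / (X + \<epsilon>)) + \<beta> * (B x / (Y + \<epsilon>))"
        proof (cases "A x = 0 \<or> B x = 0")
          case True
          then show ?thesis using A(2)[of x] B(2)[of x] x X Y e ab by auto
        next
          case False
          then show ?thesis using A(2)[of x] B(2)[of x] x X Y e ab
            by (intro Youngs_inequality_0) (auto simp: less_le)
        qed
      qed (simp add: C_def)
      finally show ?thesis using le[OF x] by simp
    qed
    then have "integral S F \<le> integral S (\<lambda>x. C * (\<alpha> * (A x / (X + \<epsilon>)) + \<beta> * (B x / (Y + \<epsilon>))))"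
      by (intro integral_le_off_negligible[OF F _ N] integrable_on_mult_right integrable_add integrable_on_divide A B) auto
    also have "\<dots> = C * (\<alpha> * (X / (X + \<epsilon>)) + \<beta> * (Y / (Y + \<epsilon>)))"
      using A(1) B(1) by (subst integral_mult_right, subst integral_add)
        (auto simp: X_def Y_def intro!: integrable_on_mult_right integrable_on_divide)
    also have "\<dots> \<le> C * (\<alpha> * 1 + \<beta> * 1)"
      using X Y e ab by (intro mult_left_mono add_mono) (auto simp: C_def)
    finally show ?thesis using ab by (simp add: C_def)
  qed
  then have "eventually (\<lambda>\<epsilon>. integral S F \<le> (X + \<epsilon>) powr \<alpha> * (Y + \<epsilon>) powr \<beta>) (at_right 0)"
    by (auto simp: eventually_at_filter)
  moreover have "((\<lambda>\<epsilon>. (X + \<epsilon>) powr \<alpha> * (Y + \<epsilon>) powr \<beta>) \<longlongrightarrow> (X + 0) powr \<alpha> * (Y + 0) powr \<beta>) (at_right 0)"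
    using X Y ab by (intro tendsto_intros tendsto_powr' disjI2 conjI)
      (auto simp: eventually_at_filter)
  ultimately have "integral S F \<le> (X + 0) powr \<alpha> * (Y + 0) powr \<beta>"
    by (intro tendsto_lowerbound[of _ _ "at_right (0::real)"]) auto
  then show ?thesis by (simp add: X_def Y_def)
qed

lemma abs_cont_deriv_integral:
  assumes "g absolutely_integrable_on {a..b}"
  shows "abs_cont_deriv a b (\<lambda>x. integral {a..x} g) g"
  unfolding abs_cont_deriv_def
proof (intro conjI allI impI assms)
  fix x y assume xy: "a \<le> x" "x \<le> y" "y \<le> b"
  have "g integrable_on {a..y}"
    using absolutely_integrable_on_subinterval[OF assms, of a y] xy
    by (auto simp: absolutely_integrable_on_def)
  from Henstock_Kurzweil_Integration.integral_combine[OF xy(1,2) this]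
  show "integral {a..y} g - integral {a..x} g = integral {x..y} g" by simp
qed

lemma integrable_energy_terms:
  fixes p l b :: real and u u' q v :: "real \<Rightarrow> real"
  assumes v: "v absolutely_integrable_on {0..b}" and q: "q absolutely_integrable_on {0..b}"
    and u: "continuous_on {0..b} u" "continuous_on {0..b} u'" and pl: "0 < l" "l < p"
  shows "(\<lambda>t. v t * \<bar>u' t\<bar> powr p) absolutely_integrable_on {0..b}"
    and "(\<lambda>t. q t * \<bar>u t\<bar> powr l * \<bar>u' t\<bar> powr (p - l)) absolutely_integrable_on {0..b}"
proof -
  have "continuous_on {0..b} (\<lambda>t. \<bar>u' t\<bar> powr p)"
    using pl by (intro continuous_on_abs_powr u) auto
  from absolutely_integrable_mult_continuous[OF this v]
  show "(\<lambda>t. v t * \<bar>u' t\<bar> powr p) absolutely_integrable_on {0..b}"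
    by (simp add: mult.commute)
  have "continuous_on {0..b} (\<lambda>t. \<bar>u t\<bar> powr l * \<bar>u' t\<bar> powr (p - l))"
    using pl by (intro continuous_on_abs_powr continuous_intros u) auto
  from absolutely_integrable_mult_continuous[OF this q]
  show "(\<lambda>t. q t * \<bar>u t\<bar> powr l * \<bar>u' t\<bar> powr (p - l)) absolutely_integrable_on {0..b}"
    by (simp add: ac_simps)
qed

text \<open>
  The integrand of \<open>K_const p l 0 r q v\<close> wherever its inner integral is finite, with real values so that
  Hoelder's inequality applies to it.
\<close>

definition K_integrand :: "real \<Rightarrow> real \<Rightarrow> (real \<Rightarrow> real) \<Rightarrow> (real \<Rightarrow> real) \<Rightarrow> real \<Rightarrow> real" where
  "K_integrand p l q v t = q t powr (p / l) * v t powr (- ((p - l) / l)) *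
     integral {0..t} (\<lambda>\<sigma>. v \<sigma> powr (- 1 / (p - 1))) powr (p - 1)"

text \<open>
  Write \<open>F t\<close> and \<open>V t\<close> for the integrals over \<open>{0..t}\<close> of \<open>v * \<bar>u'\<bar> powr p\<close> and \<open>v powr (-1/(p - 1))\<close>.
  Hoelder's inequality gives \<open>\<bar>u\<bar> \<le> F powr (1/p) * V powr ((p - 1)/p)\<close>. Inserted in the left-hand side this
  leaves \<open>K_integrand powr (l/p)\<close> times \<open>(F powr (l/(p - l)) * F') powr ((p - l)/p)\<close>, and a second application of
  Hoelder's inequality separates the factors. The last one is a derivative: \<open>F powr (l/(p - l)) * F'\<close> has the
  primitive \<open>(p - l)/p * F powr (p/(p - l))\<close>, which explains the constant. Only the part of the
  interval to the right of \<open>s\<close> contributes, as \<open>u\<close> vanishes on \<open>{0..s}\<close>.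
\<close>

lemma Opial_inequality:
  fixes p l s b :: real and u u' q v :: "real \<Rightarrow> real"
  assumes p: "1 < p" and l: "0 < l" "l < p" and sb: "0 \<le> s" "s \<le> b"
    and u: "abs_cont_deriv 0 b u u'" "continuous_on {0..b} u'"
    and vanish: "\<And>t. 0 \<le> t \<Longrightarrow> t \<le> s \<Longrightarrow> u t = 0"
    and v: "v absolutely_integrable_on {0..b}"
    and W: "(\<lambda>t. v t powr (- 1 / (p - 1))) absolutely_integrable_on {0..b}"
    and q: "q absolutely_integrable_on {0..b}"
    and N: "negligible N" "\<And>t. t \<in> {0..b} - N \<Longrightarrow> 0 < v t" "\<And>t. t \<in> {0..b} - N \<Longrightarrow> 0 \<le> q t"
    and Q: "K_integrand p l q v integrable_on {s..b}"
  shows "integral {0..b} (\<lambda>t. q t * \<bar>u t\<bar> powr l * \<bar>u' t\<bar> powr (p - l)) \<le>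
    ((p - l) / p) powr ((p - l) / p) * integral {s..b} (K_integrand p l q v) powr (l / p) *
    integral {0..b} (\<lambda>t. v t * \<bar>u' t\<bar> powr p)"
proof -
  define D where "D t = v t * \<bar>u' t\<bar> powr p" for t
  define F where "F t = integral {0..t} D" for t
  define W where "W t = v t powr (- 1 / (p - 1))" for t
  define V where "V t = integral {0..t} W" for t
  define J where "J t = q t * \<bar>u t\<bar> powr l * \<bar>u' t\<bar> powr (p - l)" for t
  define c where "c = p / (p - l)"
  have c: "c > 1" using l by (simp add: c_def field_simps)
  have u_cont: "continuous_on {0..b} u" by (rule abs_cont_deriv_continuous[OF u(1)])
  have D_int: "D absolutely_integrable_on {0..b}" and J_int: "J absolutely_integrable_on {0..b}"
    using integrable_energy_terms[OF v q u_cont u(2) l] by (simp_all add: D_def[abs_def] J_def[abs_def])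
  have W_int: "W absolutely_integrable_on {0..b}" using W by (simp add: W_def[abs_def])
  have D_nonneg: "0 \<le> D t" if "t \<in> {0..b} - N" for t
    using N(2)[OF that] by (simp add: D_def)
  have F_ac: "abs_cont_deriv 0 b F D"
    unfolding F_def by (rule abs_cont_deriv_integral[OF D_int])
  have F_nonneg: "0 \<le> F t" if "t \<le> b" for t
    using integral_le_off_negligible[OF integrable_0 abs_cont_derivD(4)[OF F_ac] N(1), of 0 t] that D_nonneg
    by (auto simp: F_def)
  have V_nonneg: "0 \<le> V t" if "t \<le> b" for t
    using abs_cont_derivD(4)[OF abs_cont_deriv_integral[OF W_int], of 0 t] that
    by (auto simp: V_def W_def intro!: integral_nonneg)
  have u0: "u 0 = 0" using vanish sb by simp
  \<comment> \<open>Hoelder with the weight split as \<open>v powr (1/p) * v powr (-1/p)\<close>.\<close>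
  have u_le: "\<bar>u t\<bar> \<le> F t powr (1 / p) * V t powr ((p - 1) / p)" if t: "t \<in> {0..b}" for t
  proof -
    have "\<bar>u t\<bar> = \<bar>integral {0..t} u'\<bar>"
      using abs_cont_derivD(2)[OF u(1), of 0 t] t u0 by simp
    also have "\<dots> \<le> integral {0..t} (\<lambda>x. \<bar>u' x\<bar>)"
      unfolding real_norm_def[symmetric]
      by (rule integral_norm_bound_integral) (use abs_cont_derivD(4,5)[OF u(1)] t in auto)
    also have "\<dots> \<le> F t powr (1 / p) * V t powr ((p - 1) / p)"
      unfolding F_def V_def
    proof (rule integral_Holder_powr[OF _ _ _ _ _ N(1)])
      show "D integrable_on {0..t}" using abs_cont_derivD(4)[OF F_ac] t by simp
      show "W integrable_on {0..t}"
        using abs_cont_derivD(4)[OF abs_cont_deriv_integral[OF W_int]] t by simp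
      show "(\<lambda>x. \<bar>u' x\<bar>) integrable_on {0..t}" using abs_cont_derivD(5)[OF u(1)] t by simp
      show "\<bar>u' x\<bar> \<le> D x powr (1 / p) * W x powr ((p - 1) / p)" if x: "x \<in> {0..t} - N" for x
      proof -
        have "v x > 0" using N(2) x t by auto
        then have "D x powr (1 / p) * W x powr ((p - 1) / p) = (v x powr (1 / p) * v x powr (- (1 / p))) * \<bar>u' x\<bar>"
          using p by (simp add: D_def W_def powr_mult powr_powr)
        also have "\<dots> = \<bar>u' x\<bar>"
          using \<open>v x > 0\<close> by (simp flip: powr_add)
        finally show ?thesis by simp
      qed
    qed (use p t D_nonneg in \<open>auto simp: W_def diff_divide_distrib\<close>)
    finally show ?thesis .
  qed
  define B where "B t = F t powr (c - 1) * D t" for t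
  have B_ac: "abs_cont_deriv 0 b (\<lambda>t. \<bar>F t\<bar> powr c) (\<lambda>t. c * signed_powr (c - 1) (F t) * D t)"
    by (rule abs_cont_deriv_compose[OF F_ac abs_powr_has_deriv[OF c]])
       (use c in \<open>auto intro!: continuous_intros continuous_signed_powr\<close>)
  have cB: "c * signed_powr (c - 1) (F t) * D t = c * B t" if "t \<in> {s..b}" for t
    using F_nonneg[of t] that by (cases "F t = 0") (auto simp: B_def signed_powr_def)
  have cB_int: "(\<lambda>t. c * B t) integrable_on {s..b}"
    using abs_cont_derivD(4)[OF B_ac, of s b] sb integrable_cong[of "{s..b}", OF cB] by simp
  then have B_int: "B integrable_on {s..b}"
    using integrable_on_mult_right[OF cB_int, of "1 / c"] c by simp
  have "c * integral {s..b} B = integral {s..b} (\<lambda>t. c * signed_powr (c - 1) (F t) * D t)"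
    using integral_cong[of "{s..b}", OF cB] by simp
  also have "\<dots> = F b powr c - F s powr c"
    using abs_cont_derivD(2)[OF B_ac, of s b] sb F_nonneg[of s] F_nonneg[of b] by simp
  also have "\<dots> \<le> F b powr c" by simp
  finally have B_le: "integral {s..b} B \<le> F b powr c / c"
    using c by (simp add: field_simps)
  have "integral {s..b} J \<le> integral {s..b} (K_integrand p l q v) powr (l / p) * integral {s..b} B powr ((p - l) / p)"
  proof (rule integral_Holder_powr[OF Q _ B_int _ _ N(1)])
    show "J integrable_on {s..b}"
      using absolutely_integrable_on_subinterval[OF J_int, of s b] sb by (auto simp: absolutely_integrable_on_def)
    fix x assume x: "x \<in> {s..b} - N"
    then have v_pos: "v x > 0" and q_nonneg: "q x \<ge> 0" and x': "x \<in> {0..b}" using N sb by auto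
    show "0 \<le> K_integrand p l q v x" by (simp add: K_integrand_def)
    show "0 \<le> B x" using v_pos by (simp add: B_def D_def)
    have Kx: "K_integrand p l q v x = q x powr (p / l) * v x powr (- ((p - l) / l)) * V x powr (p - 1)"
      by (simp add: K_integrand_def V_def W_def[abs_def])
    have e1: "(c - 1) * ((p - l) / p) = l / p" using l p by (simp add: c_def field_simps)
    have F0: "F x \<ge> 0" and V0: "V x \<ge> 0" using F_nonneg V_nonneg x' by auto
    have K1: "K_integrand p l q v x powr (l / p) = q x * v x powr (- ((p - l) / p)) * V x powr ((p - 1) * l / p)"
    proof -
      have "- ((p - l) / p) = (l - p) / p" by (simp add: diff_divide_distrib)
      then show ?thesis
        unfolding Kx using v_pos q_nonneg V0 l p by (simp add: powr_mult powr_powr)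
    qed
    have B1: "B x powr ((p - l) / p) = F x powr (l / p) * (v x powr ((p - l) / p) * \<bar>u' x\<bar> powr (p - l))"
      unfolding B_def D_def using v_pos F0 e1 l p by (simp add: powr_mult powr_powr)
    have "J x = q x * \<bar>u' x\<bar> powr (p - l) * \<bar>u x\<bar> powr l" by (simp add: J_def)
    also have "\<dots> \<le> q x * \<bar>u' x\<bar> powr (p - l) * (F x powr (1 / p) * V x powr ((p - 1) / p)) powr l"
      using u_le[OF x'] q_nonneg l by (intro mult_left_mono powr_mono2) auto
    also have "\<dots> = q x * \<bar>u' x\<bar> powr (p - l) * (F x powr (l / p) * V x powr ((p - 1) * l / p))"
      using F0 V0 by (simp add: powr_mult powr_powr)
    also have "\<dots> = K_integrand p l q v x powr (l / p) * B x powr ((p - l) / p)"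
    proof -
      have "v x powr (- ((p - l) / p)) * v x powr ((p - l) / p) = 1"
        using v_pos by (simp flip: powr_add)
      then show ?thesis unfolding K1 B1 by (simp add: ac_simps)
    qed
    finally show "J x \<le> K_integrand p l q v x powr (l / p) * B x powr ((p - l) / p)" .
  qed (use l p in \<open>auto simp: field_simps\<close>)
  also have "\<dots> \<le> integral {s..b} (K_integrand p l q v) powr (l / p) * (F b powr c / c) powr ((p - l) / p)"
  proof -
    have "0 \<le> integral {s..b} B"
      using integral_le_off_negligible[OF integrable_0 B_int N(1)] D_nonneg sb by (auto simp: B_def)
    then show ?thesis
      using B_le l p by (intro mult_left_mono powr_mono2) auto
  qed
  also have "(F b powr c / c) powr ((p - l) / p) = ((p - l) / p) powr ((p - l) / p) * F b"
  proof -
    have "c * ((p - l) / p) = 1" "1 / c = (p - l) / p" using l p by (auto simp: c_def field_simps)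
    then have "(F b powr c * (1 / c)) powr ((p - l) / p) = F b powr 1 * ((p - l) / p) powr ((p - l) / p)"
      using F_nonneg[of b] l p by (simp add: powr_mult powr_powr del: divide_divide_eq_right times_divide_eq_right)
    then show ?thesis using F_nonneg[of b] by (simp add: mult.commute)
  qed
  finally have "integral {s..b} J \<le> ((p - l) / p) powr ((p - l) / p) * integral {s..b} (K_integrand p l q v) powr (l / p) * F b"
    by (simp add: ac_simps)
  moreover have "integral {0..b} J = integral {s..b} J"
  proof -
    have "integral {0..s} J + integral {s..b} J = integral {0..b} J"
      using J_int sb by (intro Henstock_Kurzweil_Integration.integral_combine) (auto simp: absolutely_integrable_on_def)
    moreover have "integral {0..s} J = integral {0..s} (\<lambda>_. 0)"
      by (rule integral_cong) (use vanish in \<open>auto simp: J_def\<close>)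
    ultimately show ?thesis by simp
  qed
  ultimately show ?thesis by (simp add: J_def[abs_def] F_def D_def[abs_def])
qed

section \<open>The constant of the Opial inequality\<close>

lemma ennpowr_ennreal: "0 \<le> x \<Longrightarrow> ennpowr (ennreal x) c = ennreal (x powr c)"
  by (simp add: ennpowr_def)

lemma ennpowr_mono:
  assumes "x \<le> y" "0 \<le> c"
  shows "ennpowr x c \<le> ennpowr y c"
proof (cases "y = \<infinity>")
  case False
  with assms have "x \<noteq> \<infinity>" "enn2real x \<le> enn2real y"
    by (auto simp: top.not_eq_extremum intro: enn2real_mono)
  with False assms show ?thesis
    by (auto simp: ennpowr_def intro!: ennreal_leI powr_mono2)
qed (simp add: ennpowr_def)

lemma set_nn_integral_einterval_eq_integral:
  fixes f :: "real \<Rightarrow> real"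
  assumes "f integrable_on {0..r}" "\<And>t. t \<in> {0<..<r} \<Longrightarrow> 0 \<le> f t"
  shows "(\<integral>\<^sup>+t\<in>einterval 0 (ereal r). ennreal (f t) \<partial>lebesgue) = ennreal (integral {0..r} f)"
proof -
  have "(f has_integral integral {0..r} f) {0<..<r}"
    using integrable_integral[OF assms(1)] by (simp add: has_integral_Icc_iff_Ioo)
  from nn_integral_has_integral_lebesgue'[OF assms(2) this] show ?thesis
    by (simp add: nn_integral_completion zero_ereal_def)
qed

lemma K_const_mono:
  assumes "0 < l" "0 < p" "r \<le> R"
  shows "K_const p l 0 r q v \<le> K_const p l 0 R q v"
  unfolding K_const_def
proof (intro mult_left_mono ennpowr_mono nn_integral_mono)
  show "indicator (einterval 0 r) t \<le> (indicator (einterval 0 R) t :: ennreal)" for t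
    using assms(3) by (auto simp: indicator_def einterval_iff)
qed (use assms in auto)

text \<open>
  Finiteness of the extended integral is what makes the integrand integrable, so that Opial's
  inequality applies.
\<close>

lemma K_const_eq_integral:
  fixes p l r :: real
  assumes p: "1 < p" and l: "0 < l" "l < p"
    and v: "v absolutely_integrable_on {0..r}"
    and W: "(\<lambda>t. v t powr (- 1 / (p - 1))) absolutely_integrable_on {0..r}"
    and q: "q absolutely_integrable_on {0..r}"
    and fin: "K_const p l 0 (ereal r) q v < \<infinity>"
  shows "K_integrand p l q v absolutely_integrable_on {0..r}"
    and "K_const p l 0 (ereal r) q v =
      ennreal (((p - l) / p) powr ((p - l) / p) * integral {0..r} (K_integrand p l q v) powr (l / p))"
proof -
  define c where "c = ((p - l) / p) powr ((p - l) / p)"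
  have c: "c > 0" using p l by (simp add: c_def)
  let ?k = "K_integrand p l q v"
  have k_nonneg: "?k t \<ge> 0" for t by (simp add: K_integrand_def)
  have V_ac: "abs_cont_deriv 0 r (\<lambda>t. integral {0..t} (\<lambda>\<sigma>. v \<sigma> powr (- 1 / (p - 1)))) (\<lambda>\<sigma>. v \<sigma> powr (- 1 / (p - 1)))"
    by (rule abs_cont_deriv_integral[OF W])
  have inner: "ennreal (q t powr (p / l) * v t powr (- ((p - l) / l))) *
      ennpowr (\<integral>\<^sup>+\<sigma>\<in>einterval 0 (ereal t). ennreal (v \<sigma> powr (- 1 / (p - 1))) \<partial>lebesgue) (p - 1)
      = ennreal (?k t)" if t: "t \<in> einterval 0 (ereal r)" for t
  proof -
    have "(\<integral>\<^sup>+\<sigma>\<in>einterval 0 (ereal t). ennreal (v \<sigma> powr (- 1 / (p - 1))) \<partial>lebesgue)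
        = ennreal (integral {0..t} (\<lambda>\<sigma>. v \<sigma> powr (- 1 / (p - 1))))"
      by (rule set_nn_integral_einterval_eq_integral)
         (use abs_cont_derivD(4)[OF V_ac, of 0 t] t in \<open>auto simp: einterval_iff\<close>)
    moreover have "0 \<le> integral {0..t} (\<lambda>\<sigma>. v \<sigma> powr (- 1 / (p - 1)))"
      by (rule integral_nonneg) (use abs_cont_derivD(4)[OF V_ac, of 0 t] t in \<open>auto simp: einterval_iff\<close>)
    ultimately show ?thesis
      by (simp add: K_integrand_def ennpowr_ennreal ennreal_mult')
  qed
  have K: "K_const p l 0 (ereal r) q v =
      ennreal c * ennpowr (\<integral>\<^sup>+t\<in>einterval 0 (ereal r). ennreal (?k t) \<partial>lebesgue) (l / p)"
  proof -
    have "(\<integral>\<^sup>+t\<in>einterval 0 (ereal r). (ennreal (q t powr (p / l) * v t powr (- ((p - l) / l))) *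
        ennpowr (\<integral>\<^sup>+\<sigma>\<in>einterval 0 (ereal t). ennreal (v \<sigma> powr (- 1 / (p - 1))) \<partial>lebesgue) (p - 1)) \<partial>lebesgue)
        = (\<integral>\<^sup>+t\<in>einterval 0 (ereal r). ennreal (?k t) \<partial>lebesgue)"
    proof (rule nn_integral_cong)
      fix t
      show "ennreal (q t powr (p / l) * v t powr (- ((p - l) / l))) *
          ennpowr (\<integral>\<^sup>+\<sigma>\<in>einterval 0 (ereal t). ennreal (v \<sigma> powr (- 1 / (p - 1))) \<partial>lebesgue) (p - 1) *
          indicator (einterval 0 (ereal r)) t = ennreal (?k t) * indicator (einterval 0 (ereal r)) t"
        by (cases "t \<in> einterval 0 (ereal r)") (simp only: inner, simp)
    qed
    then show ?thesis by (simp only: K_const_def c_def)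
  qed
  have "(\<integral>\<^sup>+t\<in>einterval 0 (ereal r). ennreal (?k t) \<partial>lebesgue) \<noteq> \<infinity>"
    using fin c unfolding K by (auto simp: ennpowr_def ennreal_mult_top)
  then have N: "(\<integral>\<^sup>+t. ennreal (indicator {0<..<r} t * ?k t) \<partial>lebesgue) < \<infinity>"
    by (simp add: zero_ereal_def top.not_eq_extremum ennreal_indicator ennreal_mult' mult.commute k_nonneg
          flip: ennreal_indicator)
  have "?k \<in> borel_measurable (lebesgue_on {0..r})"
  proof -
    have [measurable]: "q \<in> borel_measurable (lebesgue_on {0..r})" "v \<in> borel_measurable (lebesgue_on {0..r})"
      using q v by (auto intro: absolutely_integrable_imp_borel_measurable)
    have [measurable]: "(\<lambda>t. integral {0..t} (\<lambda>\<sigma>. v \<sigma> powr (- 1 / (p - 1)))) \<in> borel_measurable (lebesgue_on {0..r})"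
      by (intro continuous_imp_measurable_on_sets_lebesgue abs_cont_deriv_continuous[OF V_ac]) auto
    show ?thesis unfolding K_integrand_def[abs_def] by measurable
  qed
  then have "?k \<in> borel_measurable (lebesgue_on {0<..<r})"
    by (rule measurable_restrict_mono) auto
  then have "(\<lambda>t. indicator {0<..<r} t *\<^sub>R ?k t) \<in> borel_measurable lebesgue"
    by (simp add: borel_measurable_restrict_space_iff)
  then have "integrable lebesgue (\<lambda>t. indicator {0<..<r} t *\<^sub>R ?k t)"
    by (rule integrableI_nonneg) (use N k_nonneg in auto)
  then have "?k absolutely_integrable_on {0<..<r}"
    by (simp only: set_integrable_def)
  then show k: "?k absolutely_integrable_on {0..r}"
    by (simp only: absolutely_integrable_on_Icc_iff_Ioo)
  have "(\<integral>\<^sup>+t\<in>einterval 0 (ereal r). ennreal (?k t) \<partial>lebesgue) = ennreal (integral {0..r} ?k)"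
    by (rule set_nn_integral_einterval_eq_integral)
       (use k k_nonneg in \<open>auto simp: absolutely_integrable_on_def\<close>)
  moreover have "0 \<le> integral {0..r} ?k"
    by (rule integral_nonneg) (use k k_nonneg in \<open>auto simp: absolutely_integrable_on_def\<close>)
  ultimately show "K_const p l 0 (ereal r) q v = ennreal (((p - l) / p) powr ((p - l) / p) * integral {0..r} ?k powr (l / p))"
    unfolding K by (simp add: ennpowr_ennreal ennreal_mult' c_def)
qed

section \<open>The primitive of an odd function with a sign\<close>

lemma AE_einterval_obtain_negligible:
  assumes "AE t\<in>einterval 0 R in lebesgue. P t"
  obtains N where "negligible N" "\<And>r t. ereal r < R \<Longrightarrow> t \<in> {0..r} - N \<Longrightarrow> P t"
proof -
  obtain N where N: "negligible N" "{t. \<not> (t \<in> einterval 0 R \<longrightarrow> P t)} \<subseteq> N"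
    using assms unfolding eventually_ae_filter_negligible by blast
  show ?thesis
  proof (rule that[of "insert 0 N"])
    show "negligible (insert 0 N)" using N(1) by simp
    fix r t assume r: "ereal r < R" and t: "t \<in> {0..r} - insert 0 N"
    then have "{t..r} \<subseteq> einterval 0 R" by (intro einterval_Icc) auto
    with t N(2) show "P t" by auto
  qed
qed

text \<open>
  A property that holds almost everywhere holds on a dense set.
\<close>

lemma AE_lebesgue_meets_open:
  assumes "AE x in lebesgue. P x" "open U" "(U :: real set) \<noteq> {}"
  obtains x where "x \<in> U" "P x"
proof -
  obtain N where N: "negligible N" "{t. \<not> P t} \<subseteq> N"
    using assms(1) unfolding eventually_ae_filter_negligible by blast
  have "\<not> U \<subseteq> N" using open_not_negligible[OF assms(2,3)] N(1) negligible_subset by blast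
  with N(2) that show ?thesis by blast
qed

lemma primitive_has_deriv:
  assumes "continuous_on UNIV \<phi>"
  shows "(primitive \<phi> has_real_derivative \<phi> x) (at x)"
proof -
  have "((\<lambda>u. LBINT y=ereal 0..ereal u. \<phi> y) has_vector_derivative \<phi> x) (at x within {- \<bar>x\<bar> - 1..\<bar>x\<bar> + 1})"
    by (rule interval_integral_FTC2) (use assms continuous_on_subset in auto)
  moreover have "at x within {- \<bar>x\<bar> - 1..\<bar>x\<bar> + 1} = at x"
    by (rule at_within_interior) auto
  ultimately show ?thesis
    by (simp add: primitive_def[abs_def] has_real_derivative_iff_has_vector_derivative zero_ereal_def)
qed

lemma primitive_0: "primitive \<phi> 0 = 0"
  by (simp add: primitive_def flip: zero_ereal_def)

lemma primitive_abs:
  assumes "continuous_on UNIV \<phi>" "\<And>x. \<phi> (- x) = - \<phi> x"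
  shows "primitive \<phi> \<bar>x\<bar> = primitive \<phi> x"
proof -
  have "((\<lambda>x. primitive \<phi> (- x) - primitive \<phi> x) has_real_derivative 0) (at y)" for y
    using assms(2)
    by (auto intro!: derivative_eq_intros DERIV_chain2[OF primitive_has_deriv[OF assms(1)]]
          primitive_has_deriv[OF assms(1)])
  then have "primitive \<phi> (- x) - primitive \<phi> x = primitive \<phi> (- 0) - primitive \<phi> 0"
    by (intro DERIV_isconst_all[of "\<lambda>x. primitive \<phi> (- x) - primitive \<phi> x"]) auto
  then show ?thesis by (simp add: abs_if)
qed

text \<open>
  By continuity \<open>\<phi>\<close> is nonnegative on the positive half-line. Strictness needs only one point of \<open>(x,y)\<close>
  at which \<open>\<phi>\<close> is positive.
\<close>

lemma primitive_strict_mono: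
  assumes \<phi>: "continuous_on UNIV \<phi>" and pos: "AE \<tau> in lebesgue. \<tau> * \<phi> \<tau> > 0"
    and xy: "0 \<le> x" "x < y"
  shows "primitive \<phi> x < primitive \<phi> y"
proof -
  have nonneg: "\<phi> z \<ge> 0" if "z > 0" for z
  proof (rule ccontr)
    assume "\<not> \<phi> z \<ge> 0"
    have "open ({w. \<phi> w < 0} \<inter> {0<..})"
      using \<phi> by (intro open_Int open_Collect_less) auto
    moreover have "z \<in> {w. \<phi> w < 0} \<inter> {0<..}"
      using \<open>\<not> \<phi> z \<ge> 0\<close> \<open>z > 0\<close> by simp
    ultimately obtain w where "w \<in> {w. \<phi> w < 0} \<inter> {0<..}" "w * \<phi> w > 0"
      using AE_lebesgue_meets_open[OF pos] by blast
    then show False by (auto simp: zero_less_mult_iff)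
  qed
  have mono: "primitive \<phi> s \<le> primitive \<phi> t" if "0 \<le> s" "s \<le> t" for s t
  proof (rule DERIV_nonneg_imp_increasing_open[OF that(2)])
    show "\<exists>D. (primitive \<phi> has_real_derivative D) (at w) \<and> 0 \<le> D" if "s < w" "w < t" for w
      using primitive_has_deriv[OF \<phi>, of w] nonneg[of w] that \<open>0 \<le> s\<close> by auto
    show "continuous_on {s..t} (primitive \<phi>)"
      by (intro continuous_at_imp_continuous_on ballI DERIV_isCont[OF primitive_has_deriv[OF \<phi>]])
  qed
  obtain z where z: "x < z" "z < y" "z * \<phi> z > 0"
    using AE_lebesgue_meets_open[OF pos, of "{x<..<y}"] xy by auto
  then have "\<phi> z > 0" using xy by (auto simp: zero_less_mult_iff)
  then obtain d where d: "d > 0" "\<And>h. 0 < h \<Longrightarrow> h < d \<Longrightarrow> primitive \<phi> z < primitive \<phi> (z + h)"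
    using DERIV_pos_inc_right[OF primitive_has_deriv[OF \<phi>]] by blast
  define k where "k = min (d / 2) (y - z)"
  have k: "0 < k" "k < d" "z + k \<le> y" using d z by (auto simp: k_def)
  have "primitive \<phi> x \<le> primitive \<phi> z" using z xy by (intro mono) auto
  also have "\<dots> < primitive \<phi> (z + k)" by (rule d(2)[OF k(1,2)])
  also have "\<dots> \<le> primitive \<phi> y" using z xy k by (intro mono) auto
  finally show ?thesis .
qed

lemma le_ext_inverse_primitive:
  assumes \<phi>: "continuous_on UNIV \<phi>" and pos: "AE \<tau> in lebesgue. \<tau> * \<phi> \<tau> > 0"
    and x: "0 \<le> x" and le: "primitive \<phi> x \<le> y"
  shows "ereal x \<le> ext_inverse (primitive \<phi>) y"
proof (cases "ereal y \<ge> (SUP x\<in>{0..}. ereal (primitive \<phi> x))")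
  case True
  then show ?thesis by (simp add: ext_inverse_def)
next
  case False
  then obtain z where z: "0 \<le> z" "y < primitive \<phi> z"
    by (auto simp: not_le less_SUP_iff)
  have "0 \<le> primitive \<phi> x"
    using primitive_strict_mono[OF \<phi> pos, of 0 x] x primitive_0[of \<phi>] by (cases "x = 0") auto
  then have "primitive \<phi> 0 \<le> y" using le by (simp add: primitive_0)
  then have "\<exists>w\<ge>0. w \<le> z \<and> primitive \<phi> w = y"
    using z by (intro IVT') (auto intro!: continuous_at_imp_continuous_on DERIV_isCont[OF primitive_has_deriv[OF \<phi>]])
  then have y: "y \<in> primitive \<phi> ` {0..}" by auto
  define w where "w = inv_into {0..} (primitive \<phi>) y"
  have w: "0 \<le> w" "primitive \<phi> w = y"
    using inv_into_into[OF y] f_inv_into_f[OF y] by (auto simp: w_def)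
  have "x \<le> w"
    using primitive_strict_mono[OF \<phi> pos w(1), of x] le w(2) by (cases "w < x") auto
  then show ?thesis using False by (simp add: ext_inverse_def w_def)
qed

section \<open>The energy identity\<close>

lemma admissible_u'_continuous:
  assumes "1 < p" "admissible p R u u'"
  shows "continuous_on (half_open R) u'"
proof -
  have y: "continuous_on (half_open R) (\<lambda>t. Phi_p p (u' t))"
    using assms(2) by (simp add: admissible_def W11_loc_half_open_def)
  have "signed_powr (1 / (p - 1)) (Phi_p p (u' t)) = u' t" for t
    unfolding Phi_p_eq_signed_powr using assms(1) by (intro signed_powr_inverse) simp
  with continuous_on_compose2[OF continuous_signed_powr[of "1 / (p - 1)" UNIV] y] assms(1)
  show ?thesis by simp
qed

lemma admissible_abs_cont_deriv:
  assumes p: "1 < p" and adm: "admissible p R u u'" and r: "0 < r" "ereal r < R"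
  shows "abs_cont_deriv 0 r u u'"
proof (rule abs_cont_deriv_closed_interval[OF _ _ _ r(1)])
  have uc: "continuous_on (half_open R) u" and uw: "weak_deriv_on (einterval 0 R) u u'"
    using adm by (simp_all add: admissible_def)
  show "continuous_on {0..r} u"
    using uc half_open_Icc[OF r(2)] continuous_on_subset by blast
  show "u' absolutely_integrable_on {0..r}"
    using admissible_u'_continuous[OF p adm] half_open_Icc[OF r(2)] continuous_on_subset
    by (intro absolutely_integrable_continuous_real) blast
  show "abs_cont_deriv s t u u'" if "0 < s" "s \<le> t" "t < r" for s t
  proof (rule abs_cont_deriv_einterval[OF uc uw that(1)])
    show "ereal t < R" using that(3) r(2) by (meson less_ereal.simps(1) less_trans)
  qed
qed

text \<open>
  The kinetic part is \<open>1/p' * a * \<bar>Phi_p p u'\<bar> powr p'\<close> with the conjugate exponent \<open>p' = p/(p - 1)\<close>.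
\<close>

definition energy :: "real \<Rightarrow> (real \<Rightarrow> real) \<Rightarrow> (real \<Rightarrow> real) \<Rightarrow> (real \<Rightarrow> real) \<Rightarrow> (real \<Rightarrow> real) \<Rightarrow> real \<Rightarrow> real" where
  "energy p \<phi> a u u' t = (1 - 1 / p) * (a t * \<bar>u' t\<bar> powr p) + primitive \<phi> (u t)"

text \<open>
  Only \<open>Phi_p p u'\<close>, not \<open>u'\<close>, is known to be absolutely continuous. Hence \<open>\<bar>u'\<bar> powr p\<close> is written as
  \<open>\<bar>Phi_p p u'\<bar> powr c\<close> with \<open>c = p/(p - 1)\<close>; this power is continuously differentiable because \<open>c > 1\<close>, and its
  derivative at \<open>Phi_p p u'\<close> is \<open>c * u'\<close>.
\<close>

lemma energy_abs_cont_deriv: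
  assumes p: "1 < p" and \<phi>: "continuous_on UNIV \<phi>"
    and a: "abs_cont_deriv 0 r a a'" and u: "abs_cont_deriv 0 r u u'"
    and y: "abs_cont_deriv 0 r (\<lambda>t. Phi_p p (u' t)) y'"
  shows "abs_cont_deriv 0 r (energy p \<phi> a u u')
    (\<lambda>t. (1 - 1 / p) * (a' t * \<bar>u' t\<bar> powr p) + a t * y' t * u' t + \<phi> (u t) * u' t)"
proof -
  define c where "c = p / (p - 1)"
  have c: "c > 1" "(p - 1) * c = p" "c - 1 = 1 / (p - 1)" "(1 - 1 / p) * c = 1"
    using p by (auto simp: c_def field_simps)
  have val: "\<bar>Phi_p p x\<bar> powr c = \<bar>x\<bar> powr p" for x
    using c by (simp add: Phi_p_eq_signed_powr abs_signed_powr powr_powr)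
  have der: "signed_powr (c - 1) (Phi_p p x) = x" for x
    unfolding c(3) Phi_p_eq_signed_powr using p by (intro signed_powr_inverse) simp
  have "abs_cont_deriv 0 r (\<lambda>t. \<bar>Phi_p p (u' t)\<bar> powr c) (\<lambda>t. c * signed_powr (c - 1) (Phi_p p (u' t)) * y' t)"
    by (rule abs_cont_deriv_compose[OF y abs_powr_has_deriv[OF c(1)]])
       (use c p in \<open>intro continuous_intros continuous_signed_powr; simp\<close>)
  then have "abs_cont_deriv 0 r (\<lambda>t. \<bar>u' t\<bar> powr p) (\<lambda>t. c * u' t * y' t)"
    by (simp only: val der)
  note ap = abs_cont_deriv_mult[OF a this]
  have pr: "abs_cont_deriv 0 r (\<lambda>t. primitive \<phi> (u t)) (\<lambda>t. \<phi> (u t) * u' t)"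
    by (rule abs_cont_deriv_compose[OF u primitive_has_deriv[OF \<phi>] \<phi>])
  have "(1 - 1 / p) * (a' t * \<bar>u' t\<bar> powr p + a t * (c * u' t * y' t)) + 1 * (\<phi> (u t) * u' t)
      = (1 - 1 / p) * (a' t * \<bar>u' t\<bar> powr p) + a t * y' t * u' t + \<phi> (u t) * u' t" for t
  proof -
    have "(1 - 1 / p) * (a t * (c * u' t * y' t)) = ((1 - 1 / p) * c) * (a t * u' t * y' t)"
      by (simp only: ac_simps)
    then show ?thesis unfolding c(4) by (simp add: distrib_left ac_simps)
  qed
  with abs_cont_deriv_lincomb[OF ap pr, of "1 - 1 / p" 1] show ?thesis
    by (simp add: energy_def[abs_def])
qed

lemma Phi_p_times: "Phi_p p x * x = \<bar>x\<bar> powr p"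
proof (cases "x = 0")
  case False
  then have "\<bar>x\<bar> powr p = \<bar>x\<bar> powr (p - 1) * \<bar>x\<bar>"
    using powr_add[of "\<bar>x\<bar>" "p - 1" 1] by simp
  then show ?thesis using False
    by (cases x "0::real" rule: linorder_cases) (auto simp: Phi_p_eq_signed_powr signed_powr_def)
qed (simp add: Phi_p_def)

text \<open>
  What both forms of the equation imply, with \<open>v\<close> the coefficient belonging to the form. The estimates
  use nothing else about a solution.
\<close>

definition energy_solution ::
  "real \<Rightarrow> ereal \<Rightarrow> (real \<Rightarrow> real) \<Rightarrow> (real \<Rightarrow> real) \<Rightarrow> (real \<Rightarrow> real \<Rightarrow> real \<Rightarrow> real) \<Rightarrow> (real \<Rightarrow> real) \<Rightarrow>
   (real \<Rightarrow> real) \<Rightarrow> (real \<Rightarrow> real) \<Rightarrow> bool" where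
  "energy_solution p R \<phi> a h v u u' \<longleftrightarrow> admissible p R u u' \<and>
     (\<forall>r. 0 < r \<longrightarrow> ereal r < R \<longrightarrow> (\<exists>e. abs_cont_deriv 0 r (energy p \<phi> a u u') e \<and>
        negligible {t \<in> {0..r}. e t \<noteq> h t (u t) (u' t) * u' t - v t * \<bar>u' t\<bar> powr p}))"

lemma ND_solution_energy_solution:
  assumes p: "1 < p" and \<phi>: "continuous_on UNIV \<phi>"
    and a: "W11_loc_half_open R a" "weak_deriv_on (einterval 0 R) a a'"
    and sol: "ND_solution p n R \<phi> a h u u'"
  shows "energy_solution p R \<phi> a h (delta_coeff p n a a') u u'"
  unfolding energy_solution_def
proof (intro conjI allI impI)
  show adm: "admissible p R u u'" using sol by (simp add: ND_solution_def)
  fix r assume r: "0 < r" "ereal r < R"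
  obtain w where w: "weak_deriv_on (einterval 0 R) (\<lambda>\<tau>. Phi_p p (u' \<tau>)) w"
    and eq: "AE \<tau>\<in>einterval 0 R in lebesgue. a \<tau> * w \<tau> + (n - 1) * a \<tau> / \<tau> * Phi_p p (u' \<tau>)
            - h \<tau> (u \<tau>) (u' \<tau>) + \<phi> (u \<tau>) = 0"
    using sol by (auto simp: ND_solution_def)
  obtain N where N: "negligible N" "\<And>r t. ereal r < R \<Longrightarrow> t \<in> {0..r} - N \<Longrightarrow>
      a t * w t + (n - 1) * a t / t * Phi_p p (u' t) - h t (u t) (u' t) + \<phi> (u t) = 0"
    using AE_einterval_obtain_negligible[OF eq] by blast
  have "abs_cont_deriv 0 r (\<lambda>t. Phi_p p (u' t)) w"
    using adm by (intro W11_loc_half_open_abs_cont_deriv[OF _ w r]) (simp add: admissible_def)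
  note E = energy_abs_cont_deriv[OF p \<phi> W11_loc_half_open_abs_cont_deriv[OF a r] admissible_abs_cont_deriv[OF p adm r] this]
  have "(1 - 1 / p) * (a' t * \<bar>u' t\<bar> powr p) + a t * w t * u' t + \<phi> (u t) * u' t
      = h t (u t) (u' t) * u' t - delta_coeff p n a a' t * \<bar>u' t\<bar> powr p" if "t \<in> {0..r} - N" for t
  proof -
    have "(a t * w t + \<phi> (u t)) * u' t = (h t (u t) (u' t) - (n - 1) * a t / t * Phi_p p (u' t)) * u' t"
      using N(2)[OF r(2) that] by simp
    also have "\<dots> = h t (u t) (u' t) * u' t - (n - 1) * a t / t * \<bar>u' t\<bar> powr p"
      by (simp only: left_diff_distrib mult.assoc Phi_p_times)
    finally show ?thesis by (simp add: delta_coeff_def algebra_simps)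
  qed
  then have "{t \<in> {0..r}. (1 - 1 / p) * (a' t * \<bar>u' t\<bar> powr p) + a t * w t * u' t + \<phi> (u t) * u' t
      \<noteq> h t (u t) (u' t) * u' t - delta_coeff p n a a' t * \<bar>u' t\<bar> powr p} \<subseteq> N"
    by blast
  with E N(1) negligible_subset
  show "\<exists>e. abs_cont_deriv 0 r (energy p \<phi> a u u') e \<and>
    negligible {t \<in> {0..r}. e t \<noteq> h t (u t) (u' t) * u' t - delta_coeff p n a a' t * \<bar>u' t\<bar> powr p}"
    by blast
qed

lemma D_solution_energy_solution:
  assumes p: "1 < p" and \<phi>: "continuous_on UNIV \<phi>"
    and a: "W11_loc_half_open R a" "weak_deriv_on (einterval 0 R) a a'"
    and sol: "D_solution p n R \<phi> a h u u'"
  shows "energy_solution p R \<phi> a h (d_coeff p n a a') u u'"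
  unfolding energy_solution_def
proof (intro conjI allI impI)
  show adm: "admissible p R u u'" using sol by (simp add: D_solution_def)
  fix r assume r: "0 < r" "ereal r < R"
  obtain w where w: "weak_deriv_on (einterval 0 R) (\<lambda>\<tau>. a \<tau> * Phi_p p (u' \<tau>)) w"
    and eq: "AE \<tau>\<in>einterval 0 R in lebesgue. w \<tau> + (n - 1) * a \<tau> / \<tau> * Phi_p p (u' \<tau>)
            - h \<tau> (u \<tau>) (u' \<tau>) + \<phi> (u \<tau>) = 0"
    using sol by (auto simp: D_solution_def)
  obtain N where N: "negligible N" "\<And>r t. ereal r < R \<Longrightarrow> t \<in> {0..r} - N \<Longrightarrow>
      w t + (n - 1) * a t / t * Phi_p p (u' t) - h t (u t) (u' t) + \<phi> (u t) = 0"
    using AE_einterval_obtain_negligible[OF eq] by blast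
  have y_W11: "W11_loc_half_open R (\<lambda>t. Phi_p p (u' t))"
    using adm by (simp add: admissible_def)
  obtain y' where y': "abs_cont_deriv 0 r (\<lambda>t. Phi_p p (u' t)) y'"
    using W11_loc_half_open_ex_abs_cont_deriv[OF y_W11 r] .
  have a_ac: "abs_cont_deriv 0 r a a'" by (rule W11_loc_half_open_abs_cont_deriv[OF a r])
  \<comment> \<open>The product rule identifies \<open>w\<close> almost everywhere.\<close>
  have "continuous_on (half_open R) (\<lambda>t. a t * Phi_p p (u' t))"
    using a(1) y_W11 by (intro continuous_intros) (simp_all add: W11_loc_half_open_def)
  from weak_deriv_on_ae_unique[OF this w abs_cont_deriv_mult[OF a_ac y'] r(2)]
  have N': "negligible {t \<in> {0..r}. w t \<noteq> a' t * Phi_p p (u' t) + a t * y' t}" .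
  note E = energy_abs_cont_deriv[OF p \<phi> a_ac admissible_abs_cont_deriv[OF p adm r] y']
  have "(1 - 1 / p) * (a' t * \<bar>u' t\<bar> powr p) + a t * y' t * u' t + \<phi> (u t) * u' t
      = h t (u t) (u' t) * u' t - d_coeff p n a a' t * \<bar>u' t\<bar> powr p"
    if "t \<in> {0..r} - (N \<union> {t \<in> {0..r}. w t \<noteq> a' t * Phi_p p (u' t) + a t * y' t})" for t
  proof -
    have "(a' t * Phi_p p (u' t) + a t * y' t + \<phi> (u t)) * u' t
        = (h t (u t) (u' t) - (n - 1) * a t / t * Phi_p p (u' t)) * u' t"
      using N(2)[OF r(2), of t] that by simp
    also have "\<dots> = h t (u t) (u' t) * u' t - (n - 1) * a t / t * \<bar>u' t\<bar> powr p"
      by (simp only: left_diff_distrib mult.assoc Phi_p_times)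
    finally have "a' t * \<bar>u' t\<bar> powr p + a t * y' t * u' t + \<phi> (u t) * u' t
        = h t (u t) (u' t) * u' t - (n - 1) * a t / t * \<bar>u' t\<bar> powr p"
      by (simp only: distrib_right mult.assoc Phi_p_times)
    then show ?thesis by (simp add: d_coeff_def algebra_simps)
  qed
  then have "{t \<in> {0..r}. (1 - 1 / p) * (a' t * \<bar>u' t\<bar> powr p) + a t * y' t * u' t + \<phi> (u t) * u' t
      \<noteq> h t (u t) (u' t) * u' t - d_coeff p n a a' t * \<bar>u' t\<bar> powr p}
      \<subseteq> N \<union> {t \<in> {0..r}. w t \<noteq> a' t * Phi_p p (u' t) + a t * y' t}"
    by blast
  with E negligible_Un[OF N(1) N'] negligible_subset
  show "\<exists>e. abs_cont_deriv 0 r (energy p \<phi> a u u') e \<and>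
    negligible {t \<in> {0..r}. e t \<noteq> h t (u t) (u' t) * u' t - d_coeff p n a a' t * \<bar>u' t\<bar> powr p}"
    by blast
qed

section \<open>Energy estimates\<close>

text \<open>
  The hypotheses shared by the two forms of the equation; \<open>v\<close> may be any positive weight here.
\<close>

locale radial_problem =
  fixes p l \<theta> :: real and R :: ereal
    and \<phi> a q v :: "real \<Rightarrow> real" and h :: "real \<Rightarrow> real \<Rightarrow> real \<Rightarrow> real"
  assumes p: "1 < p" and l: "0 < l" "l < p" and \<theta>: "0 < \<theta>"
    and \<phi>_cont: "continuous_on UNIV \<phi>" and \<phi>_odd: "\<And>\<tau>. \<phi> (- \<tau>) = - \<phi> \<tau>"
    and \<phi>_sign: "AE \<tau> in lebesgue. \<tau> * \<phi> \<tau> > 0"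
    and a_cont: "continuous_on (half_open R) a"
    and a_pos: "AE \<tau>\<in>einterval 0 R in lebesgue. a \<tau> > 0"
    and q_nonneg: "\<And>\<tau>. \<tau> \<in> einterval 0 R \<Longrightarrow> q \<tau> \<ge> 0"
    and q_L1: "L1_loc_half_open R q"
    and v_pos: "AE \<tau>\<in>einterval 0 R in lebesgue. v \<tau> > 0"
    and v_L1: "L1_loc_half_open R v"
    and W_L1: "L1_loc_half_open R (\<lambda>\<tau>. v \<tau> powr (- 1 / (p - 1)))"
    and h_bound: "AE \<tau>\<in>einterval 0 R in lebesgue. \<forall>x y.
           h \<tau> x y * y \<le> \<theta> * q \<tau> * \<bar>x\<bar> powr l * \<bar>y\<bar> powr (p - l)
                            + (1 - \<theta>) * v \<tau> * \<bar>y\<bar> powr p"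
    and K_fin: "\<And>r. 0 < r \<Longrightarrow> ereal r < R \<Longrightarrow> K_const p l 0 (ereal r) q v < \<infinity>"
begin

abbreviation k :: "real \<Rightarrow> real" where "k \<equiv> K_integrand p l q v"

lemma L1_Icc:
  assumes "0 < r" "ereal r < R"
  shows "q absolutely_integrable_on {0..r}" "v absolutely_integrable_on {0..r}"
    "(\<lambda>t. v t powr (- 1 / (p - 1))) absolutely_integrable_on {0..r}"
  using q_L1 v_L1 W_L1 assms by (auto simp: L1_loc_half_open_def absolutely_integrable_on_Icc_iff_Ioo)

lemma k_integrable:
  assumes "0 < r" "ereal r < R" "0 \<le> s"
  shows "k integrable_on {s..r}"
  using absolutely_integrable_on_subinterval[OF K_const_eq_integral(1)[OF p l L1_Icc(2,3,1)[OF assms(1,2)] K_fin[OF assms(1,2)]], of s r]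
    assms(3) by (auto simp: absolutely_integrable_on_def)

lemma K_const_eq:
  assumes "0 < r" "ereal r < R"
  shows "K_const p l 0 (ereal r) q v =
    ennreal (((p - l) / p) powr ((p - l) / p) * integral {0..r} k powr (l / p))"
  by (rule K_const_eq_integral(2)[OF p l L1_Icc(2,3,1)[OF assms] K_fin[OF assms]])

text \<open>
  On a set of full measure \<open>a > 0\<close>; continuity extends the weak inequality to every point, the origin
  included.
\<close>

lemma a_nonneg:
  assumes "t \<in> half_open R"
  shows "0 \<le> a t"
proof -
  have t: "0 \<le> t" "ereal t < R" using assms by (auto simp: half_open_def)
  obtain r where r: "t < r" "ereal r < R" using ereal_dense2[OF t(2)] by auto
  obtain N where N: "negligible N" "\<And>r t. ereal r < R \<Longrightarrow> t \<in> {0..r} - N \<Longrightarrow> 0 < a t"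
    using AE_einterval_obtain_negligible[OF a_pos] by blast
  have cont: "continuous_on {t..r} a"
    using a_cont half_open_Icc[OF r(2)] t(1) by (elim continuous_on_subset) auto
  have pos: "0 \<le> a x" if "x \<in> {t<..<r}" for x
  proof (rule ccontr)
    assume "\<not> 0 \<le> a x"
    have "open ({t<..<r} \<inter> a -` {..<0})"
      by (rule continuous_open_preimage) (use cont in \<open>auto elim: continuous_on_subset\<close>)
    moreover have "{t<..<r} \<inter> a -` {..<0} \<subseteq> N"
    proof
      fix w assume w: "w \<in> {t<..<r} \<inter> a -` {..<0}"
      then have "w \<in> {0..r}" "\<not> 0 < a w" using t(1) by auto
      then show "w \<in> N" using N(2)[OF r(2), of w] by blast
    qed
    moreover have "x \<in> {t<..<r} \<inter> a -` {..<0}" using that \<open>\<not> 0 \<le> a x\<close> by simp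
    ultimately show False
      using open_not_negligible[of "{t<..<r} \<inter> a -` {..<0}"] negligible_subset[OF N(1)] by blast
  qed
  have "t \<in> closure {t<..<r}" using r by simp
  moreover have "continuous_on (closure {t<..<r}) a" using cont r by simp
  ultimately show ?thesis
    using continuous_ge_on_closure[of "{t<..<r}" a t 0] pos by blast
qed

lemma primitive_le_0_imp:
  assumes "primitive \<phi> x \<le> 0"
  shows "x = 0"
  using primitive_strict_mono[OF \<phi>_cont \<phi>_sign, of 0 "\<bar>x\<bar>"] assms
  by (cases "x = 0") (simp_all add: primitive_0 primitive_abs[OF \<phi>_cont \<phi>_odd])

text \<open>
  The hypothesis \<open>small\<close> says that the constant in Opial's inequality is at most one, so that the term
  coming from \<open>q\<close> is absorbed by the dissipation \<open>v * \<bar>u'\<bar> powr p\<close>.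
\<close>

lemma energy_le_initial:
  assumes sol: "energy_solution p R \<phi> a h v u u'" and r: "0 < r" "ereal r < R"
    and s: "0 \<le> s" "s \<le> r" and vanish: "\<And>t. 0 \<le> t \<Longrightarrow> t \<le> s \<Longrightarrow> u t = 0"
    and small: "((p - l) / p) powr ((p - l) / p) * integral {s..r} k powr (l / p) \<le> 1"
  shows "energy p \<phi> a u u' r \<le> energy p \<phi> a u u' 0"
proof -
  have adm: "admissible p R u u'" using sol by (simp add: energy_solution_def)
  obtain e where e: "abs_cont_deriv 0 r (energy p \<phi> a u u') e"
    and e_eq: "negligible {t \<in> {0..r}. e t \<noteq> h t (u t) (u' t) * u' t - v t * \<bar>u' t\<bar> powr p}" (is "negligible ?N")
    using sol r by (auto simp: energy_solution_def)
  have u: "abs_cont_deriv 0 r u u'" by (rule admissible_abs_cont_deriv[OF p adm r])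
  have u'_cont: "continuous_on {0..r} u'"
    using admissible_u'_continuous[OF p adm] half_open_Icc[OF r(2)] continuous_on_subset by blast
  obtain Nh where Nh: "negligible Nh" "\<And>r t. ereal r < R \<Longrightarrow> t \<in> {0..r} - Nh \<Longrightarrow>
      \<forall>x y. h t x y * y \<le> \<theta> * q t * \<bar>x\<bar> powr l * \<bar>y\<bar> powr (p - l) + (1 - \<theta>) * v t * \<bar>y\<bar> powr p"
    using AE_einterval_obtain_negligible[OF h_bound] by blast
  obtain Nv where Nv: "negligible Nv" "\<And>r t. ereal r < R \<Longrightarrow> t \<in> {0..r} - Nv \<Longrightarrow> 0 < v t"
    using AE_einterval_obtain_negligible[OF v_pos] by blast
  \<comment> \<open>The sign of \<open>q\<close> is known on the open interval only, hence the extra point 0.\<close>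
  have Nv0: "negligible (insert 0 Nv)" using Nv(1) by simp
  define J where "J t = q t * \<bar>u t\<bar> powr l * \<bar>u' t\<bar> powr (p - l)" for t
  define D where "D t = v t * \<bar>u' t\<bar> powr p" for t
  have J_int: "J integrable_on {0..r}" and D_int: "D integrable_on {0..r}"
    using integrable_energy_terms[OF L1_Icc(2,1)[OF r] abs_cont_deriv_continuous[OF u] u'_cont l]
    by (simp_all add: J_def[abs_def] D_def[abs_def] absolutely_integrable_on_def)
  have "energy p \<phi> a u u' r - energy p \<phi> a u u' 0 = integral {0..r} e"
    using abs_cont_derivD(2)[OF e, of 0 r] r by simp
  also have "\<dots> \<le> integral {0..r} (\<lambda>t. \<theta> * (J t - D t))"
  proof (rule integral_le_off_negligible[OF _ _ negligible_Un[OF Nh(1) e_eq]])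
    show "e integrable_on {0..r}" using abs_cont_derivD(4)[OF e] by simp
    show "(\<lambda>t. \<theta> * (J t - D t)) integrable_on {0..r}"
      by (intro integrable_on_mult_right integrable_diff J_int D_int)
    fix t assume t: "t \<in> {0..r} - (Nh \<union> ?N)"
    then have "e t = h t (u t) (u' t) * u' t - v t * \<bar>u' t\<bar> powr p" by blast
    moreover have "h t (u t) (u' t) * u' t \<le> \<theta> * q t * \<bar>u t\<bar> powr l * \<bar>u' t\<bar> powr (p - l) + (1 - \<theta>) * v t * \<bar>u' t\<bar> powr p"
      using Nh(2)[OF r(2), of t] t by blast
    ultimately show "e t \<le> \<theta> * (J t - D t)"
      by (simp add: J_def D_def algebra_simps)
  qed
  also have "\<dots> = \<theta> * (integral {0..r} J - integral {0..r} D)"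
    using J_int D_int by (simp add: integral_diff)
  also have "\<dots> \<le> 0"
  proof -
    have D0: "0 \<le> integral {0..r} D"
      using integral_le_off_negligible[OF integrable_0 D_int Nv(1)] Nv(2)[OF r(2)]
      by (auto simp: D_def less_imp_le)
    have "integral {0..r} J \<le> ((p - l) / p) powr ((p - l) / p) * integral {s..r} k powr (l / p) * integral {0..r} D"
      unfolding J_def D_def
    proof (rule Opial_inequality[OF p l s u u'_cont vanish L1_Icc(2,3,1)[OF r] Nv0])
      show "0 \<le> q t" if "t \<in> {0..r} - insert 0 Nv" for t
        using that einterval_Icc[of t r R] r by (intro q_nonneg) auto
    qed (use Nv(2)[OF r(2)] k_integrable[OF r s(1)] in auto)
    also have "\<dots> \<le> 1 * integral {0..r} D"
      by (rule mult_right_mono[OF small D0])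
    finally show ?thesis using \<theta> by (simp add: mult_nonneg_nonpos)
  qed
  finally show ?thesis by simp
qed

lemma primitive_le_energy:
  assumes "t \<in> half_open R"
  shows "primitive \<phi> (u t) \<le> energy p \<phi> a u u' t"
  using a_nonneg[OF assms] p by (simp add: energy_def)

lemma initial_energy:
  assumes "admissible p R u u'"
  shows "energy p \<phi> a u u' 0 = (1 - 1 / p) * a 0 * \<bar>u' 0\<bar> powr p"
  using assms by (simp add: energy_def admissible_def primitive_0)

lemma abs_le_ext_inverse:
  assumes sol: "energy_solution p R \<phi> a h v u u'" and K: "K_const p l 0 R q v \<le> 1"
    and r: "r \<in> einterval 0 R"
  shows "ereal \<bar>u r\<bar> \<le> ext_inverse (primitive \<phi>) ((1 - 1 / p) * a 0 * \<bar>u' 0\<bar> powr p)"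
proof (rule le_ext_inverse_primitive[OF \<phi>_cont \<phi>_sign])
  have r': "0 < r" "ereal r < R" using r by (auto simp: einterval_iff)
  have adm: "admissible p R u u'" using sol by (simp add: energy_solution_def)
  have "K_const p l 0 (ereal r) q v \<le> 1"
    using K_const_mono[of l p "ereal r" R q v] K l p r' by (meson less_imp_le less_trans order_trans)
  then have "((p - l) / p) powr ((p - l) / p) * integral {0..r} k powr (l / p) \<le> 1"
    unfolding K_const_eq[OF r'] by simp
  then have "energy p \<phi> a u u' r \<le> energy p \<phi> a u u' 0"
    using adm r' by (intro energy_le_initial[OF sol r', of 0]) (auto simp: admissible_def)
  then show "primitive \<phi> \<bar>u r\<bar> \<le> (1 - 1 / p) * a 0 * \<bar>u' 0\<bar> powr p"
    using primitive_le_energy[of r u u'] r einterval_subset_half_open[of R]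
    by (auto simp: initial_energy[OF adm] primitive_abs[OF \<phi>_cont \<phi>_odd])
qed simp

text \<open>
  Around every point there is a neighbourhood in which the integral of \<open>K_integrand\<close> is so small that
  \<open>u = 0\<close> passes from the left end of any subinterval to its right end. Bisection glues these local
  statements together.
\<close>

lemma zero_solution:
  assumes sol: "energy_solution p R \<phi> a h v u u'" and init: "a 0 = 0 \<or> u' 0 = 0"
    and t: "t \<in> half_open R"
  shows "u t = 0"
proof (cases "t = 0")
  case False
  have adm: "admissible p R u u'" using sol by (simp add: energy_solution_def)
  have u0: "u 0 = 0" using adm by (simp add: admissible_def)
  have E0: "energy p \<phi> a u u' 0 = 0" using init by (auto simp: initial_energy[OF adm])
  have tR: "0 < t" "ereal t < R" using t False by (auto simp: half_open_def)
  define c where "c = ((p - l) / p) powr ((p - l) / p)"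
  have c: "c > 0" using l p by (simp add: c_def)
  \<comment> \<open>Integrals of \<open>k\<close> up to \<open>\<eta>\<close> give a constant of at most one in Opial's inequality.\<close>
  define \<eta> where "\<eta> = (1 / c) powr (p / l)"
  have \<eta>: "\<eta> > 0" "c * \<eta> powr (l / p) = 1"
    using c l p by (auto simp: \<eta>_def powr_powr)
  define I where "I x = integral {0..x} k" for x
  have I_cont: "continuous_on {0..t} I"
    unfolding I_def by (rule indefinite_integral_continuous_1[OF k_integrable[OF tR order_refl]])
  have I_diff: "integral {x..y} k = I y - I x" if "0 \<le> x" "x \<le> y" "y \<le> t" for x y
  proof -
    have "k integrable_on {0..y}"
      using integrable_subinterval_real[OF k_integrable[OF tR order_refl], of 0 y] that by auto
    from Henstock_Kurzweil_Integration.integral_combine[OF that(1,2) this]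
    show ?thesis by (simp add: I_def)
  qed
  define P where "P x y \<longleftrightarrow> (0 \<le> x \<longrightarrow> y \<le> t \<longrightarrow> (\<forall>z\<in>{0..x}. u z = 0) \<longrightarrow> (\<forall>z\<in>{0..y}. u z = 0))" for x y
  have "P 0 t"
    using less_imp_le[OF tR(1)]
  proof (induction rule: Bolzano)
    case (trans x y z)
    show ?case
      unfolding P_def
    proof (intro impI)
      assume x: "0 \<le> x" and z: "z \<le> t" and van: "\<forall>w\<in>{0..x}. u w = 0"
      have "y \<le> t" "0 \<le> y" using trans(3,4) x z by simp_all
      then show "\<forall>w\<in>{0..z}. u w = 0"
        using trans(1,2) x z van unfolding P_def by blast
    qed
  next
    case (local m)
    then have m: "m \<in> {0..t}" by auto
    obtain d where d: "d > 0" "\<And>x. x \<in> {0..t} \<Longrightarrow> \<bar>x - m\<bar> < d \<Longrightarrow> \<bar>I x - I m\<bar> < \<eta> / 2"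
      using I_cont m \<eta>(1) unfolding continuous_on_iff dist_real_def by (metis half_gt_zero)
    show ?case
      unfolding P_def
    proof (intro exI[of _ d] conjI allI impI d(1) ballI)
      fix x y z
      assume xy: "x \<le> m \<and> m \<le> y \<and> y - x < d" "0 \<le> x" "y \<le> t"
        and van: "\<forall>z\<in>{0..x}. u z = 0" and z: "z \<in> {0..y}"
      show "u z = 0"
      proof (cases "z \<le> x")
        case True with van z show ?thesis by auto
      next
        case False
        then have xz: "0 < z" "x \<le> z" "z \<le> t" using xy z by auto
        then have zR: "ereal z < R" using tR(2) by (meson ereal_less_eq(3) le_less_trans)
        have "\<bar>I x - I m\<bar> < \<eta> / 2"
          using xy z False by (intro d(2)) auto
        moreover have "\<bar>I z - I m\<bar> < \<eta> / 2"
          using xy z False by (intro d(2)) auto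
        ultimately have "integral {x..z} k < \<eta>"
          unfolding I_diff[OF xy(2) xz(2,3)] by linarith
        moreover have "0 \<le> integral {x..z} k"
          by (rule integral_nonneg[OF k_integrable[OF xz(1) zR xy(2)]]) (simp add: K_integrand_def)
        ultimately have "integral {x..z} k powr (l / p) \<le> \<eta> powr (l / p)"
          using l p by (intro powr_mono2) auto
        then have "c * integral {x..z} k powr (l / p) \<le> 1"
          using mult_left_mono[of _ _ c] c \<eta>(2) by (metis less_imp_le)
        then have "energy p \<phi> a u u' z \<le> energy p \<phi> a u u' 0"
          using van by (intro energy_le_initial[OF sol xz(1) zR xy(2) xz(2)]) (auto simp: c_def)
        then have "primitive \<phi> (u z) \<le> 0"
          using primitive_le_energy[of z u u'] E0 xz zR by (auto simp: half_open_def)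
        then show ?thesis by (rule primitive_le_0_imp)
      qed
    qed
  qed
  with u0 tR show ?thesis by (auto simp: P_def)
qed (use sol in \<open>auto simp: energy_solution_def admissible_def\<close>)

end

section \<open>The equation satisfied by the zero function\<close>

lemma weak_deriv_on_zero:
  assumes "continuous_on (half_open R) f" "weak_deriv_on (einterval 0 R) f g"
    and "\<And>t. t \<in> einterval 0 R \<Longrightarrow> f t = 0"
  shows "negligible {t \<in> einterval 0 R. g t \<noteq> 0}"
proof (rule negligible_on_einterval)
  fix s t assume st: "0 < s" "s < t" "ereal t < R"
  have ac: "abs_cont_deriv s t f g" by (rule abs_cont_deriv_einterval[OF assms(1,2) st(1,3)])
  show "negligible {x \<in> {s..t}. g x \<noteq> 0}"
  proof (rule negligible_nonzero_if_integrals_zero)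
    show "g integrable_on {s..t}" using abs_cont_derivD(4)[OF ac] by simp
    fix x y assume xy: "s \<le> x" "x \<le> y" "y \<le> t"
    then have "f x = 0" "f y = 0"
      using einterval_Icc[OF st(1,3)] by (auto intro!: assms(3))
    with abs_cont_derivD(2)[OF ac xy] show "integral {x..y} g = 0" by simp
  qed
qed

text \<open>
  The weak derivative of zero vanishes almost everywhere, and \<open>u'\<close> is the continuous version.
\<close>

lemma admissible_zero:
  assumes p: "1 < p" and adm: "admissible p R u u'" and u: "\<And>t. t \<in> half_open R \<Longrightarrow> u t = 0"
    and t: "t \<in> einterval 0 R"
  shows "u' t = 0"
proof (rule ccontr)
  assume "u' t \<noteq> 0"
  have "negligible {t \<in> einterval 0 R. u' t \<noteq> 0}"
    using adm u einterval_subset_half_open by (intro weak_deriv_on_zero[of R u u']) (auto simp: admissible_def)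
  moreover have "{t \<in> einterval 0 R. u' t \<noteq> 0} = einterval 0 R \<inter> u' -` (- {0})" by auto
  moreover have "open (einterval 0 R \<inter> u' -` (- {0}))"
    by (rule continuous_open_preimage[OF continuous_on_subset[OF admissible_u'_continuous[OF p adm] einterval_subset_half_open]]) auto
  ultimately show False
    using open_not_negligible[of "einterval 0 R \<inter> u' -` (- {0})"] t \<open>u' t \<noteq> 0\<close> by auto
qed

lemma AE_einterval_iff:
  "(AE t\<in>einterval 0 R in lebesgue. P t) \<longleftrightarrow> negligible {t \<in> einterval 0 R. \<not> P t}"
proof -
  have "{t. \<not> (t \<in> einterval 0 R \<longrightarrow> P t)} = {t \<in> einterval 0 R. \<not> P t}" by auto
  then show ?thesis
    unfolding eventually_ae_filter_negligible by (metis negligible_subset order_refl)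
qed

lemma ND_solution_zero:
  assumes p: "1 < p" and \<phi>: "\<phi> 0 = 0" and sol: "ND_solution p n R \<phi> a h u u'"
    and u: "\<And>t. t \<in> half_open R \<Longrightarrow> u t = 0"
  shows "AE t\<in>einterval 0 R in lebesgue. h t 0 0 = 0"
proof -
  have adm: "admissible p R u u'" using sol by (simp add: ND_solution_def)
  have u': "u' t = 0" if "t \<in> einterval 0 R" for t
    by (rule admissible_zero[OF p adm u that])
  have u0: "u t = 0" if "t \<in> einterval 0 R" for t
    using that einterval_subset_half_open u by blast
  obtain w where w: "weak_deriv_on (einterval 0 R) (\<lambda>\<tau>. Phi_p p (u' \<tau>)) w"
    and eq: "AE \<tau>\<in>einterval 0 R in lebesgue. a \<tau> * w \<tau> + (n - 1) * a \<tau> / \<tau> * Phi_p p (u' \<tau>)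
            - h \<tau> (u \<tau>) (u' \<tau>) + \<phi> (u \<tau>) = 0"
    using sol by (auto simp: ND_solution_def)
  have "negligible {t \<in> einterval 0 R. w t \<noteq> 0}"
    using adm u' by (intro weak_deriv_on_zero[OF _ w]) (auto simp: admissible_def W11_loc_half_open_def Phi_p_def)
  then have "AE t\<in>einterval 0 R in lebesgue. w t = 0" by (simp add: AE_einterval_iff)
  with eq show ?thesis
    by eventually_elim (use u0 u' \<phi> in \<open>auto simp: Phi_p_def\<close>)
qed

lemma D_solution_zero:
  assumes p: "1 < p" and \<phi>: "\<phi> 0 = 0" and a: "continuous_on (half_open R) a"
    and sol: "D_solution p n R \<phi> a h u u'" and u: "\<And>t. t \<in> half_open R \<Longrightarrow> u t = 0"
  shows "AE t\<in>einterval 0 R in lebesgue. h t 0 0 = 0"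
proof -
  have adm: "admissible p R u u'" using sol by (simp add: D_solution_def)
  have u': "u' t = 0" if "t \<in> einterval 0 R" for t
    by (rule admissible_zero[OF p adm u that])
  have u0: "u t = 0" if "t \<in> einterval 0 R" for t
    using that einterval_subset_half_open u by blast
  obtain w where w: "weak_deriv_on (einterval 0 R) (\<lambda>\<tau>. a \<tau> * Phi_p p (u' \<tau>)) w"
    and eq: "AE \<tau>\<in>einterval 0 R in lebesgue. w \<tau> + (n - 1) * a \<tau> / \<tau> * Phi_p p (u' \<tau>)
            - h \<tau> (u \<tau>) (u' \<tau>) + \<phi> (u \<tau>) = 0"
    using sol by (auto simp: D_solution_def)
  have "continuous_on (half_open R) (\<lambda>t. Phi_p p (u' t))"
    using adm by (simp add: admissible_def W11_loc_half_open_def)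
  with a have "continuous_on (half_open R) (\<lambda>t. a t * Phi_p p (u' t))"
    by (intro continuous_intros)
  then have "negligible {t \<in> einterval 0 R. w t \<noteq> 0}"
    using u' by (intro weak_deriv_on_zero[OF _ w]) (auto simp: Phi_p_def)
  then have "AE t\<in>einterval 0 R in lebesgue. w t = 0" by (simp add: AE_einterval_iff)
  with eq show ?thesis
    by eventually_elim (use u0 u' \<phi> in \<open>auto simp: Phi_p_def\<close>)
qed

section \<open>A priori bound and uniqueness\<close>

theorem theorem2:
  fixes p l n \<theta> :: real and R :: ereal
    and \<phi> a a' q v :: "real \<Rightarrow> real"
    and h :: "real \<Rightarrow> real \<Rightarrow> real \<Rightarrow> real"
    and solution :: "(real \<Rightarrow> real) \<Rightarrow> (real \<Rightarrow> real) \<Rightarrow> bool"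
  assumes "1 < p" and "0 < l" and "l < p" and "1 \<le> n" and "0 < R" and "0 < \<theta>" and "\<theta> \<le> 1"
    and "continuous_on UNIV \<phi>"
    and "\<forall>\<tau>. \<phi> (- \<tau>) = - \<phi> \<tau>"
    and "AE \<tau> in lebesgue. \<tau> * \<phi> \<tau> > 0"
    and "W11_loc_half_open R a"
    and "weak_deriv_on (einterval 0 R) a a'"
    and "AE \<tau>\<in>einterval 0 R in lebesgue. a \<tau> > 0"
    and "caratheodory R h"
    and "\<forall>\<tau>\<in>einterval 0 R. q \<tau> \<ge> 0"
    and "L1_loc_half_open R q"
    and cases:
      "(v = delta_coeff p n a a' \<and> solution = ND_solution p n R \<phi> a h) \<or>
       (v = d_coeff p n a a' \<and> solution = D_solution p n R \<phi> a h)"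
    and "AE \<tau>\<in>einterval 0 R in lebesgue. v \<tau> > 0"
    and "L1_loc_half_open R v"
    and "L1_loc_half_open R (\<lambda>\<tau>. v \<tau> powr (- 1 / (p - 1)))"
    and "AE \<tau>\<in>einterval 0 R in lebesgue. \<forall>x y.
           h \<tau> x y * y \<le> \<theta> * q \<tau> * \<bar>x\<bar> powr l * \<bar>y\<bar> powr (p - l)
                            + (1 - \<theta>) * v \<tau> * \<bar>y\<bar> powr p"
    and "\<forall>r. 0 < r \<and> ereal r < R \<longrightarrow> K_const p l 0 (ereal r) q v < \<infinity>"
  shows "(K_const p l 0 R q v \<le> 1 \<longrightarrow>
           (\<forall>u u'. solution u u' \<longrightarrow>
              (SUP r\<in>einterval 0 R. ereal \<bar>u r\<bar>)
                \<le> ext_inverse (primitive \<phi>) ((1 - 1 / p) * a 0 * \<bar>u' 0\<bar> powr p)))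
       \<and> (\<forall>u u'. solution u u' \<and> (a 0 = 0 \<or> u' 0 = 0) \<longrightarrow>
              (\<forall>\<tau>\<in>half_open R. u \<tau> = 0))
       \<and> (\<not> (AE \<tau>\<in>einterval 0 R in lebesgue. h \<tau> 0 0 = 0) \<longrightarrow>
              \<not> (\<exists>u u'. solution u u' \<and> (a 0 = 0 \<or> u' 0 = 0)))"
proof -
  have a_cont: "continuous_on (half_open R) a"
    using assms(11) by (simp add: W11_loc_half_open_def)
  interpret radial_problem p l \<theta> R \<phi> a q v h
    by unfold_locales (use assms a_cont in auto)
  have energy: "energy_solution p R \<phi> a h v u u'" if "solution u u'" for u u'
    using cases that ND_solution_energy_solution[OF p \<phi>_cont assms(11,12)]
      D_solution_energy_solution[OF p \<phi>_cont assms(11,12)] by blast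
  have \<phi>0: "\<phi> 0 = 0" using \<phi>_odd[of 0] by simp
  have h0: "AE \<tau>\<in>einterval 0 R in lebesgue. h \<tau> 0 0 = 0"
    if sol: "solution u u'" and init: "a 0 = 0 \<or> u' 0 = 0" for u u'
  proof -
    have u: "u t = 0" if "t \<in> half_open R" for t
      by (rule zero_solution[OF energy[OF sol] init that])
    from cases sol consider "ND_solution p n R \<phi> a h u u'" | "D_solution p n R \<phi> a h u u'"
      by auto
    then show ?thesis
    proof cases
      case 1
      then show ?thesis by (rule ND_solution_zero[where \<phi> = \<phi>, OF p \<phi>0 _ u])
    next
      case 2
      then show ?thesis by (rule D_solution_zero[where \<phi> = \<phi>, OF p \<phi>0 a_cont _ u])
    qed
  qed
  show ?thesis
  proof (intro conjI allI impI)
    fix u u' assume "K_const p l 0 R q v \<le> 1" "solution u u'"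
    then show "(SUP r\<in>einterval 0 R. ereal \<bar>u r\<bar>) \<le> ext_inverse (primitive \<phi>) ((1 - 1 / p) * a 0 * \<bar>u' 0\<bar> powr p)"
      by (intro SUP_least abs_le_ext_inverse energy)
  next
    fix u u' assume "solution u u' \<and> (a 0 = 0 \<or> u' 0 = 0)"
    then show "\<forall>\<tau>\<in>half_open R. u \<tau> = 0"
      using zero_solution[OF energy] by blast
  qed (use h0 in blast)
qed

end
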